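(* Let $k\in\mathbb N$, $0<\alpha\le1$ and $f\in\mathcal C^{k,\alpha}(\mathbb S^2)$. For $h\in\mathbb N$ let $\Omega_h:=\{n\in\mathbb Z\times\mathbb N_0: |n|\le h\}$ and $K_hf:=S_{\Omega_h}f$. Then there is a constant $M_{k,\alpha}$ depending only on $k$ and $\alpha$ such that for all $h\in\mathbb N$ $$\|f-K_hf\|_{\mathcal C(\mathbb S^2)}\le M_{k,\alpha}\,\|f\|_{\mathcal C^{k,\alpha}(\mathbb S^2)}\,h^{1-k-\alpha}.$$
   Context: $|n|$ is the Euclidean norm of $n\in\mathbb Z^2$; $\|g\|_{\mathcal C(\mathbb S^2)}=\sup_{\mathbb S^2}|g|$. $B^d_k:=\{\beta\in\mathbb N_0^d:\sum_i\beta_i\le k\}$. For open $U\subset\mathbb R^d$: $\mathcal C^k(U)$ bounded uniformly continuous complex functions whose classical derivatives $D^\beta f$, $\beta\in B^d_k$, are bounded and uniformly continuous; for $0<\alpha<1$, $\mathcal C^{k,\alpha}(U)$ those with finite $\sup\{|D^\beta f(x)-D^\beta f(y)|/\|x-y\|^\alpha:x\ne y,|\beta|=k\}$. Sphere: for $0\le\alpha<1$, $\|f\|_{\mathcal C^{k,\alpha}(\mathbb S^2)}$ is the infimum, over all $f^*\in\mathcal C^{k,\alpha}(U)$ with $U\supset\mathbb S^2$ open and $f^*|_{\mathbb S^2}=f$ ($\mathcal C^{k,0}=\mathcal C^k$), of $\sum_{\beta\in B^3_k}\sup_{\mathbb S^2}|D^\beta f^*|$ plus (if $\alpha>0$) $\sup\{|D^\beta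 f^*(\xi)-D^\beta f^*(\eta)|/\|\xi-\eta\|^\alpha:\xi\ne\eta\in\mathbb S^2,|\beta|=k\}$; $\mathcal C^{k,\alpha}(\mathbb S^2)$ is the set where it is finite. Convention: $\mathcal C^{k,1}(\mathbb S^2):=\mathcal C^{k+1}(\mathbb S^2)$ with the same norm. DFS: $\phi(\lambda,\theta)=(\cos\lambda\sin\theta,\sin\lambda\sin\theta,\cos\theta)$, $\tilde f=f\circ\phi$ on $\mathbb T^2=\mathbb R^2/(2\pi\mathbb Z^2)$, $\phi^{-1}$ inverse of the restriction of $\phi$ to $[-\pi,\pi)\times(0,\pi)\cup\{(0,0),(0,\pi)\}$. $c_n(g)=(2\pi)^{-2}\int_{\mathbb T^2}g(x)e^{-i\langle n,x\rangle}dx$. $M(n_1,n_2)=(n_1,-n_2)$; $e_n(x)=e^{i\langle n,x\rangle}+(-1)^{n_1}e^{i\langle M(n),x\rangle}$ if $n_2\ne0$, $e_n(x)=e^{i\langle n,x\rangle}$ if $n_2=0$; $b_n=e_n\circ\phi^{-1}$; $S_\Omega f(\xi)=\sum_{n\in\Omega}c_n(\tilde f)b_n(\xi)$ for finite $\Omega\subset\mathbb Z\times\mathbb N_0$. *)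

theory Defs
  imports "HOL-Analysis.Analysis"
begin

definition S2 :: "(real^3) set" where
  "S2 = sphere 0 1"

definition pdiff :: "3 \<Rightarrow> (real^3 \<Rightarrow> complex) \<Rightarrow> real^3 \<Rightarrow> complex" where
  "pdiff i g x = vector_derivative (\<lambda>t. g (x + t *\<^sub>R axis i 1)) (at 0)"

fun Dlist :: "3 list \<Rightarrow> (real^3 \<Rightarrow> complex) \<Rightarrow> real^3 \<Rightarrow> complex" where
  "Dlist [] g = g"
| "Dlist (i # ds) g = pdiff i (Dlist ds g)"

definition mi_order :: "(3 \<Rightarrow> nat) \<Rightarrow> nat" where
  "mi_order \<beta> = (\<Sum>i\<in>UNIV. \<beta> i)"

definition mi_list :: "(3 \<Rightarrow> nat) \<Rightarrow> 3 list" where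
  "mi_list \<beta> = replicate (\<beta> 0) 0 @ replicate (\<beta> 1) 1 @ replicate (\<beta> 2) 2"

definition Dmi :: "(3 \<Rightarrow> nat) \<Rightarrow> (real^3 \<Rightarrow> complex) \<Rightarrow> real^3 \<Rightarrow> complex" where
  "Dmi \<beta> g = Dlist (mi_list \<beta>) g"

definition B3 :: "nat \<Rightarrow> (3 \<Rightarrow> nat) set" where
  "B3 k = {\<beta>. mi_order \<beta> \<le> k}"

definition Ck_open :: "nat \<Rightarrow> (real^3) set \<Rightarrow> (real^3 \<Rightarrow> complex) \<Rightarrow> bool" where
  "Ck_open k U g \<longleftrightarrow>
     (\<forall>ds. length ds < k \<longrightarrow> (\<forall>i. \<forall>x\<in>U.
         (\<lambda>t. Dlist ds g (x + t *\<^sub>R axis i 1)) differentiable (at 0)))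
   \<and> (\<forall>ds. length ds \<le> k \<longrightarrow>
         bounded (Dlist ds g ` U) \<and> uniformly_continuous_on U (Dlist ds g))"

definition Holder_open :: "nat \<Rightarrow> real \<Rightarrow> (real^3) set \<Rightarrow> (real^3 \<Rightarrow> complex) \<Rightarrow> bool" where
  "Holder_open k \<alpha> U g \<longleftrightarrow>
     (\<exists>C. \<forall>\<beta>. mi_order \<beta> = k \<longrightarrow> (\<forall>x\<in>U. \<forall>y\<in>U. x \<noteq> y \<longrightarrow>
        cmod (Dmi \<beta> g x - Dmi \<beta> g y) / norm (x - y) powr \<alpha> \<le> C))"

text \<open>C^{k,alpha}(U); alpha = 0 means C^k(U).\<close>
definition Cka_open :: "nat \<Rightarrow> real \<Rightarrow> (real^3) set \<Rightarrow> (real^3 \<Rightarrow> complex) \<Rightarrow> bool" where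
  "Cka_open k \<alpha> U g \<longleftrightarrow> Ck_open k U g \<and> (\<alpha> > 0 \<longrightarrow> Holder_open k \<alpha> U g)"

definition sphere_qty :: "nat \<Rightarrow> real \<Rightarrow> (real^3 \<Rightarrow> complex) \<Rightarrow> real" where
  "sphere_qty k \<alpha> g =
     (\<Sum>\<beta>\<in>B3 k. (SUP \<xi>\<in>S2. cmod (Dmi \<beta> g \<xi>)))
   + (if \<alpha> > 0 then
        (SUP (\<beta>, \<xi>, \<eta>) \<in> {(\<beta>, \<xi>, \<eta>). mi_order \<beta> = k \<and> \<xi> \<in> S2 \<and> \<eta> \<in> S2 \<and> \<xi> \<noteq> \<eta>}.
           cmod (Dmi \<beta> g \<xi> - Dmi \<beta> g \<eta>) / norm (\<xi> - \<eta>) powr \<alpha>)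
      else 0)"

definition extensions :: "nat \<Rightarrow> real \<Rightarrow> (real^3 \<Rightarrow> complex) \<Rightarrow> (real^3 \<Rightarrow> complex) set" where
  "extensions k \<alpha> f =
     {g. \<exists>U. open U \<and> S2 \<subseteq> U \<and> Cka_open k \<alpha> U g \<and> (\<forall>\<xi>\<in>S2. g \<xi> = f \<xi>)}"

definition in_Cka_raw :: "nat \<Rightarrow> real \<Rightarrow> (real^3 \<Rightarrow> complex) \<Rightarrow> bool" where
  "in_Cka_raw k \<alpha> f \<longleftrightarrow> extensions k \<alpha> f \<noteq> {}"

definition norm_Cka_raw :: "nat \<Rightarrow> real \<Rightarrow> (real^3 \<Rightarrow> complex) \<Rightarrow> real" where
  "norm_Cka_raw k \<alpha> f = Inf (sphere_qty k \<alpha> ` extensions k \<alpha> f)"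

text \<open>Convention: C^{k,1}(S^2) := C^{k+1}(S^2) with the same norm.\<close>
definition in_Cka_S2 :: "nat \<Rightarrow> real \<Rightarrow> (real^3 \<Rightarrow> complex) \<Rightarrow> bool" where
  "in_Cka_S2 k \<alpha> f = (if \<alpha> = 1 then in_Cka_raw (k + 1) 0 f else in_Cka_raw k \<alpha> f)"

definition norm_Cka_S2 :: "nat \<Rightarrow> real \<Rightarrow> (real^3 \<Rightarrow> complex) \<Rightarrow> real" where
  "norm_Cka_S2 k \<alpha> f = (if \<alpha> = 1 then norm_Cka_raw (k + 1) 0 f else norm_Cka_raw k \<alpha> f)"

definition sup_norm_S2 :: "(real^3 \<Rightarrow> complex) \<Rightarrow> real" where
  "sup_norm_S2 g = (SUP \<xi>\<in>S2. cmod (g \<xi>))"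

definition dfs_phi :: "real \<times> real \<Rightarrow> real^3" where
  "dfs_phi x = (\<chi> j. if j = 0 then cos (fst x) * sin (snd x)
                     else if j = 1 then sin (fst x) * sin (snd x)
                     else cos (snd x))"

definition dfs_dom :: "(real \<times> real) set" where
  "dfs_dom = ({-pi..<pi} \<times> {0<..<pi}) \<union> {(0, 0), (0, pi)}"

definition dfs_phi_inv :: "real^3 \<Rightarrow> real \<times> real" where
  "dfs_phi_inv = inv_into dfs_dom dfs_phi"

definition dfs_tilde :: "(real^3 \<Rightarrow> complex) \<Rightarrow> real \<times> real \<Rightarrow> complex" where
  "dfs_tilde f = f \<circ> dfs_phi"

definition ip :: "int \<times> int \<Rightarrow> real \<times> real \<Rightarrow> real" where
  "ip n x = of_int (fst n) * fst x + of_int (snd n) * snd x"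

text \<open>Fourier coefficient over T^2 = R^2/(2 pi Z^2), integrating over [0,2pi]^2.\<close>
definition fourier_coeff :: "(real \<times> real \<Rightarrow> complex) \<Rightarrow> int \<times> int \<Rightarrow> complex" where
  "fourier_coeff g n = complex_of_real (1 / (2 * pi)^2) *
     integral (cbox (0, 0) (2 * pi, 2 * pi)) (\<lambda>x. g x * exp (- \<i> * complex_of_real (ip n x)))"

definition Mref :: "int \<times> int \<Rightarrow> int \<times> int" where
  "Mref n = (fst n, - snd n)"

definition dfs_e :: "int \<times> int \<Rightarrow> real \<times> real \<Rightarrow> complex" where
  "dfs_e n x = (if snd n \<noteq> 0
      then exp (\<i> * complex_of_real (ip n x)) + (-1) powi (fst n) * exp (\<i> * complex_of_real (ip (Mref n) x))
      else exp (\<i> * complex_of_real (ip n x)))"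

definition dfs_b :: "int \<times> int \<Rightarrow> real^3 \<Rightarrow> complex" where
  "dfs_b n = dfs_e n \<circ> dfs_phi_inv"

definition dfs_S :: "(int \<times> int) set \<Rightarrow> (real^3 \<Rightarrow> complex) \<Rightarrow> real^3 \<Rightarrow> complex" where
  "dfs_S \<Omega> f \<xi> = (\<Sum>n\<in>\<Omega>. fourier_coeff (dfs_tilde f) n * dfs_b n \<xi>)"

definition Omega :: "nat \<Rightarrow> (int \<times> int) set" where
  "Omega h = {n. snd n \<ge> 0 \<and> sqrt (real_of_int (fst n)^2 + real_of_int (snd n)^2) \<le> real h}"

definition Kh :: "nat \<Rightarrow> (real^3 \<Rightarrow> complex) \<Rightarrow> real^3 \<Rightarrow> complex" where
  "Kh h f = dfs_S (Omega h) f"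

end

(*
  Write g for f composed with phi, a function on the torus.  Along each coordinate line phi runs
  through a circle on the sphere, so g is C^{k,alpha} in each variable separately, uniformly, and
  its difference of order k + 1 with step t is O(t^{k + alpha}) times the norm of f.  Such a
  difference multiplies the n-th Fourier coefficient by (e^{i n_1 t} - 1)^{k + 1} (or n_2), which is
  bounded away from 0 when |n_1| is comparable to 1/t.  Bessel's inequality and Cauchy-Schwarz on a
  dyadic shell, which has O(4^j) points, then bound the sum of |c_n| over the shell by
  O(2^{j (1 - k - alpha)}), and these bounds sum to the claimed rate.  By Stone-Weierstrass on the
  sphere g is a uniform limit of trigonometric polynomials; this gives the transformation rules for
  the coefficients and shows that the Fourier series converges to g.  The symmetry
  g(a + pi, -b) = g(a, b) identifies the expansion in the b_n with the symmetric partial sum over a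
  disc.
*)
theory Submission
  imports Defs
begin

section \<open>Partial derivatives on open subsets of space\<close>

text \<open>Separate smoothness in the two variables suffices because a large frequency has a large
  coordinate. Only the chain rule along circles is then needed, and its velocity has components
  \<open>a cos s + b sin s\<close>, a family closed under differentiation.

  Cauchy-Schwarz on a shell costs a factor \<open>2 ^ j\<close>, which is the power lost in the
  rate; \<open>k \<ge> 1\<close> keeps the exponent \<open>1 - k - \<alpha>\<close> negative.

  Coefficients are integrals over a fixed square, so a shift is not a mere substitution. Uniform
  limits of trigonometric polynomials serve throughout in place of continuous periodic functions,
  because identities for them reduce to exponentials.

  Three features of the definitions shape the rest. The norm sees derivatives in sorted order only,
  while the chain rule produces every order, so Schwarz's theorem enters. For
  \<open>\<alpha> = 1\<close> the class is C^(k+1), and a Lipschitz bound has to be recovered along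
  the circles, since the sphere is not convex. The norm is an infimum over extensions, so each bound
  is proved for one extension with a constant independent of it.\<close>

lemma vector_derivative_linear_approx:
  fixes f :: "real \<Rightarrow> 'b::real_normed_vector"
  assumes "\<And>t. t \<in> closed_segment a b \<Longrightarrow> (f has_vector_derivative f' t) (at t)"
    and "\<And>t. t \<in> closed_segment a b \<Longrightarrow> norm (f' t - c) \<le> e"
  shows "norm (f b - f a - (b - a) *\<^sub>R c) \<le> \<bar>b - a\<bar> * e"
proof -
  \<comment> \<open>Removing the linear part first turns the mean value inequality into a linear
    approximation.\<close>
  have "norm ((f b - b *\<^sub>R c) - (f a - a *\<^sub>R c)) \<le> e * norm (b - a)"
  proof (rule differentiable_bound[of "closed_segment a b" "\<lambda>t. f t - t *\<^sub>R c" "\<lambda>t h. h *\<^sub>R (f' t - c)"])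
    fix t assume t: "t \<in> closed_segment a b"
    have "((\<lambda>t. f t - t *\<^sub>R c) has_vector_derivative (f' t - c)) (at t within closed_segment a b)"
      using assms(1)[OF t, THEN has_vector_derivative_at_within]
      by (auto intro!: derivative_eq_intros)
    then show "((\<lambda>t. f t - t *\<^sub>R c) has_derivative (\<lambda>h. h *\<^sub>R (f' t - c))) (at t within closed_segment a b)"
      by (simp add: has_vector_derivative_def)
    show "onorm (\<lambda>h. h *\<^sub>R (f' t - c)) \<le> e"
      using assms(2)[OF t] by (intro onorm_le) (simp add: mult.commute[of e] mult_left_mono)
  qed auto
  then show ?thesis by (simp add: algebra_simps)
qed

definition partially_differentiable_on :: "(real^3 \<Rightarrow> complex) \<Rightarrow> (real^3) set \<Rightarrow> bool" where
  "partially_differentiable_on h U \<longleftrightarrow>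
     (\<forall>i. \<forall>x\<in>U. (\<lambda>t. h (x + t *\<^sub>R axis i 1)) differentiable (at 0))"

text \<open>\<open>pdiff\<close> is a derivative at parameter 0 of the axis line through the point
  itself; translating the parameter gives it at every point of one fixed line.\<close>

lemma partially_differentiable_onD:
  assumes "partially_differentiable_on h U" "x + t *\<^sub>R axis i 1 \<in> U"
  shows "((\<lambda>t. h (x + t *\<^sub>R axis i 1)) has_vector_derivative pdiff i h (x + t *\<^sub>R axis i 1)) (at t)"
proof -
  let ?f = "\<lambda>r. h ((x + t *\<^sub>R axis i 1) + r *\<^sub>R axis i 1)"
  have "(?f has_vector_derivative pdiff i h (x + t *\<^sub>R axis i 1)) (at 0)"
    using assms unfolding partially_differentiable_on_def pdiff_def
    by (simp add: vector_derivative_works[symmetric])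
  then have "((?f \<circ> (\<lambda>r. r - t)) has_vector_derivative (1 *\<^sub>R pdiff i h (x + t *\<^sub>R axis i 1))) (at t)"
    by (intro vector_diff_chain_at) (auto intro!: derivative_eq_intros)
  moreover have "?f \<circ> (\<lambda>r. r - t) = (\<lambda>r. h (x + r *\<^sub>R axis i 1))"
    by (auto simp: fun_eq_iff algebra_simps)
  ultimately show ?thesis by simp
qed

text \<open>Near parameter 0 the axis line stays in \<open>U\<close>, and a derivative sees nothing
  else. Identities between iterated derivatives are available on \<open>U\<close> only, so this is
  what lets them be differentiated.\<close>

lemma pdiff_cong_on_open:
  assumes "open U" "x \<in> U" "\<And>y. y \<in> U \<Longrightarrow> g y = h y"
  shows "pdiff i g x = pdiff i h x"
proof -
  have "open ((\<lambda>t::real. x + t *\<^sub>R axis i 1) -` U)"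
    using assms(1) by (intro open_vimage continuous_intros)
  then have "\<forall>\<^sub>F t in nhds 0. t \<in> (\<lambda>t::real. x + t *\<^sub>R axis i 1) -` U"
    using assms(2) by (intro eventually_nhds_in_open) auto
  then have "\<forall>\<^sub>F t in nhds 0. g (x + t *\<^sub>R axis i 1) = h (x + t *\<^sub>R axis i 1)"
    by eventually_elim (use assms in auto)
  then show ?thesis
    unfolding pdiff_def by (intro vector_derivative_cong_eq) (auto simp: eventually_nhds_conv_at)
qed

lemma partial_linear_approx:
  assumes "partially_differentiable_on h U"
    and "\<And>t. t \<in> closed_segment 0 s \<Longrightarrow> y + t *\<^sub>R axis i 1 \<in> U"
    and "\<And>t. t \<in> closed_segment 0 s \<Longrightarrow> norm (pdiff i h (y + t *\<^sub>R axis i 1) - c) \<le> e"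
  shows "norm (h (y + s *\<^sub>R axis i 1) - h y - s *\<^sub>R c) \<le> \<bar>s\<bar> * e"
  using vector_derivative_linear_approx[of 0 s "\<lambda>t. h (y + t *\<^sub>R axis i 1)"
      "\<lambda>t. pdiff i h (y + t *\<^sub>R axis i 1)" c e]
    partially_differentiable_onD[OF assms(1)] assms(2,3) by auto

text \<open>Provides the room for walking from \<open>x\<close> to \<open>x + v\<close> one
  coordinate at a time.\<close>

lemma truncation_in_ball:
  fixes x v w :: "real^3"
  assumes "norm v < d" "\<And>i. \<bar>w $ i\<bar> \<le> \<bar>v $ i\<bar>"
  shows "x + w \<in> ball x d"
proof -
  have "norm w \<le> norm v" using assms(2) by (intro norm_le_componentwise_cart) auto
  then show ?thesis using assms(1) by (simp add: dist_norm)
qed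

text \<open>\<open>Ck_open\<close> offers partial derivatives, while the chain rule along curves
  needs the total one. The increment is split into three axis-parallel steps, on each of which the
  partial derivative stays within \<open>e / 3\<close> of its value at \<open>x\<close>.\<close>

lemma has_derivative_continuous_partials:
  fixes h :: "real^3 \<Rightarrow> complex"
  assumes "open U" "x \<in> U" and pd: "partially_differentiable_on h U"
    and "\<And>i. continuous_on U (pdiff i h)"
  shows "(h has_derivative (\<lambda>v. \<Sum>i\<in>UNIV. (v $ i) *\<^sub>R pdiff i h x)) (at x)"
  unfolding has_derivative_at_alt
proof (intro conjI allI impI)
  show "bounded_linear (\<lambda>v. \<Sum>i\<in>UNIV. (v $ i) *\<^sub>R pdiff i h x)"
    by (intro bounded_linear_sum bounded_linear_scaleR_const bounded_linear_vec_nth)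
  fix e :: real assume e: "e > 0"
  have "\<forall>i. \<exists>d>0. \<forall>z\<in>ball x d. z \<in> U \<and> norm (pdiff i h z - pdiff i h x) \<le> e / 3"
  proof
    fix i
    have "isCont (pdiff i h) x"
      using assms by (simp add: continuous_on_eq_continuous_at)
    then obtain d1 where d1: "d1 > 0" "\<And>z. dist z x < d1 \<Longrightarrow> dist (pdiff i h z) (pdiff i h x) < e / 3"
      using e unfolding continuous_at_eps_delta by (metis divide_pos_pos zero_less_numeral dist_norm)
    obtain d2 where "d2 > 0" "ball x d2 \<subseteq> U" using assms(1,2) openE by blast
    with d1 show "\<exists>d>0. \<forall>z\<in>ball x d. z \<in> U \<and> norm (pdiff i h z - pdiff i h x) \<le> e / 3"
      by (intro exI[of _ "min d1 d2"]) (auto simp: dist_norm norm_minus_commute less_imp_le)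
  qed
  then obtain d' where d': "\<And>i. d' i > 0"
      "\<And>i z. z \<in> ball x (d' i) \<Longrightarrow> z \<in> U \<and> norm (pdiff i h z - pdiff i h x) \<le> e / 3"
    by metis
  define d where "d = Min (range d')"
  have dpos: "d > 0" and dle: "\<And>i. d \<le> d' i" using d'(1) by (auto simp: d_def)
  have d: "z \<in> U" "norm (pdiff i h z - pdiff i h x) \<le> e / 3" if "z \<in> ball x d" for z i
    using d'(2)[of z i] dle[of i] that by auto
  show "\<exists>d>0. \<forall>y. norm (y - x) < d \<longrightarrow>
      norm (h y - h x - (\<Sum>i\<in>UNIV. ((y - x) $ i) *\<^sub>R pdiff i h x)) \<le> e * norm (y - x)"
  proof (intro exI[of _ d] conjI dpos allI impI)
    fix y assume y: "norm (y - x) < d"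
    define v where "v = y - x"
    define p where "p = (\<lambda>i. pdiff i h x)"
    \<comment> \<open>The path has the corners \<open>x\<close>, \<open>x + w1\<close>,
      \<open>x + w2\<close> and \<open>x + v\<close>.\<close>
    define w1 :: "real^3" where "w1 = (v $ 1) *\<^sub>R axis 1 1"
    define w2 :: "real^3" where "w2 = w1 + (v $ 2) *\<^sub>R axis 2 1"
    have v3: "v = w2 + (v $ 3) *\<^sub>R axis 3 1"
      by (simp add: vec_eq_iff forall_3 w2_def w1_def axis_def)
    have seg: "\<bar>t\<bar> \<le> \<bar>r\<bar>" if "t \<in> closed_segment 0 r" for t r :: real
      using that by (auto simp: closed_segment_eq_real_ivl split: if_splits)
    have nv: "norm v < d" using y by (simp add: v_def)
    have b: "x + w \<in> ball x d" if "\<And>i. \<bar>w $ i\<bar> \<le> \<bar>v $ i\<bar>" for w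
      using truncation_in_ball[OF nv that] .
    have "norm (h (x + (v $ 1) *\<^sub>R axis 1 1) - h x - (v $ 1) *\<^sub>R p 1) \<le> \<bar>v $ 1\<bar> * (e/3)"
    proof (rule partial_linear_approx[OF pd], unfold p_def)
      fix t assume t: "t \<in> closed_segment 0 (v $ 1)"
      have "x + t *\<^sub>R axis 1 1 \<in> ball x d"
        by (rule b) (use seg[OF t] in \<open>simp add: axis_def\<close>)
      from d(1)[OF this] d(2)[OF this, of 1]
      show "x + t *\<^sub>R axis 1 1 \<in> U" "norm (pdiff 1 h (x + t *\<^sub>R axis 1 1) - pdiff 1 h x) \<le> e / 3" .
    qed
    moreover have "norm (h ((x + w1) + (v $ 2) *\<^sub>R axis 2 1) - h (x + w1) - (v $ 2) *\<^sub>R p 2) \<le> \<bar>v $ 2\<bar> * (e/3)"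
    proof (rule partial_linear_approx[OF pd], unfold p_def)
      fix t assume t: "t \<in> closed_segment 0 (v $ 2)"
      have "x + (w1 + t *\<^sub>R axis 2 1) \<in> ball x d"
        by (rule b) (use seg[OF t] in \<open>simp add: axis_def w1_def\<close>)
      then have "(x + w1) + t *\<^sub>R axis 2 1 \<in> ball x d" by (simp only: add.assoc)
      from d(1)[OF this] d(2)[OF this, of 2]
      show "(x + w1) + t *\<^sub>R axis 2 1 \<in> U" "norm (pdiff 2 h ((x + w1) + t *\<^sub>R axis 2 1) - pdiff 2 h x) \<le> e / 3" .
    qed
    moreover have "norm (h ((x + w2) + (v $ 3) *\<^sub>R axis 3 1) - h (x + w2) - (v $ 3) *\<^sub>R p 3) \<le> \<bar>v $ 3\<bar> * (e/3)"
    proof (rule partial_linear_approx[OF pd], unfold p_def)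
      fix t assume t: "t \<in> closed_segment 0 (v $ 3)"
      have "x + (w2 + t *\<^sub>R axis 3 1) \<in> ball x d"
        by (rule b) (use seg[OF t] in \<open>auto simp add: axis_def w1_def w2_def\<close>)
      then have "(x + w2) + t *\<^sub>R axis 3 1 \<in> ball x d" by (simp only: add.assoc)
      from d(1)[OF this] d(2)[OF this, of 3]
      show "(x + w2) + t *\<^sub>R axis 3 1 \<in> U" "norm (pdiff 3 h ((x + w2) + t *\<^sub>R axis 3 1) - pdiff 3 h x) \<le> e / 3" .
    qed
    moreover have "\<bar>v $ i\<bar> * (e/3) \<le> norm v * (e/3)" for i
      using e component_le_norm_cart[of v i] by (intro mult_right_mono) auto
    ultimately have
      "norm (h (x + w1) - h x - (v $ 1) *\<^sub>R p 1) \<le> norm v * (e/3)"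
      "norm (h (x + w2) - h (x + w1) - (v $ 2) *\<^sub>R p 2) \<le> norm v * (e/3)"
      "norm (h (x + v) - h (x + w2) - (v $ 3) *\<^sub>R p 3) \<le> norm v * (e/3)"
      using v3 unfolding w1_def w2_def by (auto simp: add.assoc intro: order_trans)
    then have "norm ((h (x + w1) - h x - (v $ 1) *\<^sub>R p 1) + (h (x + w2) - h (x + w1) - (v $ 2) *\<^sub>R p 2)
         + (h (x + v) - h (x + w2) - (v $ 3) *\<^sub>R p 3)) \<le> norm v * (e/3) + norm v * (e/3) + norm v * (e/3)"
      by (intro norm_triangle_mono) auto
    moreover have "(h (x + w1) - h x - (v $ 1) *\<^sub>R p 1) + (h (x + w2) - h (x + w1) - (v $ 2) *\<^sub>R p 2)
         + (h (x + v) - h (x + w2) - (v $ 3) *\<^sub>R p 3) = h y - h x - (\<Sum>i\<in>UNIV. (v $ i) *\<^sub>R p i)"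
      by (simp add: sum_3 v_def)
    moreover have "norm v * (e/3) + norm v * (e/3) + norm v * (e/3) = e * norm v"
      by simp
    ultimately show "norm (h y - h x - (\<Sum>i\<in>UNIV. ((y - x) $ i) *\<^sub>R pdiff i h x)) \<le> e * norm (y - x)"
      by (simp only: v_def p_def)
  qed
qed

text \<open>The second difference is the increment in direction \<open>i\<close> of an increment in
  direction \<open>j\<close>. The mean value inequality is used twice: on \<open>u\<close> in
  direction \<open>i\<close>, and inside its derivative on \<open>pdiff i h\<close> in direction
  \<open>j\<close>.\<close>

lemma mixed_second_difference_approx:
  fixes h :: "real^3 \<Rightarrow> complex"
  assumes "open U" "x \<in> U" and pd: "partially_differentiable_on h U" "partially_differentiable_on (pdiff i h) U"
    and cont: "continuous_on U (pdiff j (pdiff i h))" and e: "e > 0"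
  shows "\<exists>d>0. \<forall>s. 0 < s \<and> s < d \<longrightarrow>
    norm (h (x + s *\<^sub>R axis i 1 + s *\<^sub>R axis j 1) - h (x + s *\<^sub>R axis i 1) - h (x + s *\<^sub>R axis j 1) + h x
       - (s * s) *\<^sub>R pdiff j (pdiff i h) x) \<le> s * s * e"
proof -
  let ?p = "pdiff j (pdiff i h)"
  have "isCont ?p x" using assms by (simp add: continuous_on_eq_continuous_at)
  then obtain d1 where d1: "d1 > 0" "\<And>z. dist z x < d1 \<Longrightarrow> dist (?p z) (?p x) < e"
    using e unfolding continuous_at_eps_delta by (metis dist_norm)
  obtain d2 where d2: "d2 > 0" "ball x d2 \<subseteq> U" using assms(1,2) openE by blast
  \<comment> \<open>The half leaves room for two axis steps, each shorter than
    \<open>d\<close>.\<close>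
  define d where "d = min d1 d2 / 2"
  have dpos: "d > 0" using d1 d2 by (simp add: d_def)
  have near: "x + r *\<^sub>R axis i 1 + t *\<^sub>R axis j 1 \<in> U"
      "norm (?p (x + r *\<^sub>R axis i 1 + t *\<^sub>R axis j 1) - ?p x) \<le> e"
    if "\<bar>r\<bar> < d" "\<bar>t\<bar> < d" for r t
  proof -
    have "norm (r *\<^sub>R axis i (1::real) + t *\<^sub>R axis j 1) \<le> \<bar>r\<bar> + \<bar>t\<bar>"
      by (rule order_trans[OF norm_triangle_ineq]) (simp add: norm_axis_1)
    also have "\<dots> < min d1 d2" using that by (simp add: d_def field_simps)
    finally have *: "dist (x + r *\<^sub>R axis i 1 + t *\<^sub>R axis j 1) x < min d1 d2"
      by (simp add: dist_norm add.assoc)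
    then show "x + r *\<^sub>R axis i 1 + t *\<^sub>R axis j 1 \<in> U" using d2 by (auto simp: dist_commute)
    show "norm (?p (x + r *\<^sub>R axis i 1 + t *\<^sub>R axis j 1) - ?p x) \<le> e"
      using d1(2)[of "x + r *\<^sub>R axis i 1 + t *\<^sub>R axis j 1"] * by (simp add: dist_norm)
  qed
  show ?thesis
  proof (intro exI[of _ d] conjI dpos allI impI, elim conjE)
    fix s :: real assume s: "0 < s" "s < d"
    have seg: "0 \<le> t \<and> \<bar>t\<bar> < d" if "t \<in> closed_segment 0 s" for t
      using that s by (auto simp: closed_segment_eq_real_ivl)
    define u where "u = (\<lambda>r. h (x + s *\<^sub>R axis j 1 + r *\<^sub>R axis i 1) - h (x + r *\<^sub>R axis i 1))"
    define u' where "u' = (\<lambda>r. pdiff i h (x + s *\<^sub>R axis j 1 + r *\<^sub>R axis i 1) - pdiff i h (x + r *\<^sub>R axis i 1))"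
    have "norm (u s - u 0 - (s - 0) *\<^sub>R (s *\<^sub>R ?p x)) \<le> \<bar>s - 0\<bar> * (s * e)"
    proof (rule vector_derivative_linear_approx)
      fix r assume "r \<in> closed_segment 0 s"
      then have r: "\<bar>r\<bar> < d" using seg by blast
      have 1: "x + s *\<^sub>R axis j 1 + r *\<^sub>R axis i 1 \<in> U" "x + r *\<^sub>R axis i 1 \<in> U"
        using near(1)[OF r, of s] near(1)[OF r, of 0] s by (auto simp: algebra_simps)
      show "(u has_vector_derivative u' r) (at r)" unfolding u_def u'_def
        by (intro has_vector_derivative_diff partially_differentiable_onD[OF pd(1)] 1)
      have "norm (pdiff i h (x + r *\<^sub>R axis i 1 + s *\<^sub>R axis j 1) - pdiff i h (x + r *\<^sub>R axis i 1) - s *\<^sub>R ?p x) \<le> \<bar>s\<bar> * e"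
        by (rule partial_linear_approx[OF pd(2)]; use near r seg in blast)
      then show "norm (u' r - s *\<^sub>R ?p x) \<le> s * e"
        using s by (simp add: u'_def algebra_simps)
    qed
    then show "norm (h (x + s *\<^sub>R axis i 1 + s *\<^sub>R axis j 1) - h (x + s *\<^sub>R axis i 1) - h (x + s *\<^sub>R axis j 1) + h x
       - (s * s) *\<^sub>R pdiff j (pdiff i h) x) \<le> s * s * e"
      using s by (simp add: u_def algebra_simps)
  qed
qed

text \<open>Schwarz's theorem: the second difference is symmetric in \<open>i\<close> and
  \<open>j\<close>, so both mixed derivatives, times \<open>s * s\<close>, approximate the same
  number.\<close>

lemma pdiff_commute:
  fixes h :: "real^3 \<Rightarrow> complex"
  assumes U: "open U" "x \<in> U" and pd: "partially_differentiable_on h U"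
    "\<And>i. partially_differentiable_on (pdiff i h) U"
    and cont: "\<And>i j. continuous_on U (pdiff j (pdiff i h))"
  shows "pdiff i (pdiff j h) x = pdiff j (pdiff i h) x"
proof (rule ccontr)
  let ?a = "pdiff i (pdiff j h) x" and ?b = "pdiff j (pdiff i h) x"
  assume ne: "?a \<noteq> ?b"
  \<comment> \<open>The two errors give \<open>norm (?a - ?b) \<le> 2 * e\<close>, half of the
    left-hand side: a contradiction.\<close>
  define e where "e = norm (?a - ?b) / 4"
  have e: "e > 0" using ne by (simp add: e_def)
  obtain d1 where d1: "d1 > 0" "\<And>s. 0 < s \<Longrightarrow> s < d1 \<Longrightarrow>
    norm (h (x + s *\<^sub>R axis i 1 + s *\<^sub>R axis j 1) - h (x + s *\<^sub>R axis i 1) - h (x + s *\<^sub>R axis j 1) + h x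
       - (s * s) *\<^sub>R ?b) \<le> s * s * e"
    using mixed_second_difference_approx[OF U pd(1) pd(2) cont e, of i j] by blast
  obtain d2 where d2: "d2 > 0" "\<And>s. 0 < s \<Longrightarrow> s < d2 \<Longrightarrow>
    norm (h (x + s *\<^sub>R axis j 1 + s *\<^sub>R axis i 1) - h (x + s *\<^sub>R axis j 1) - h (x + s *\<^sub>R axis i 1) + h x
       - (s * s) *\<^sub>R ?a) \<le> s * s * e"
    using mixed_second_difference_approx[OF U pd(1) pd(2) cont e, of j i] by blast
  define s where "s = min d1 d2 / 2"
  have s: "0 < s" "s < d1" "s < d2" using d1 d2 by (auto simp: s_def)
  define D where "D = h (x + s *\<^sub>R axis i 1 + s *\<^sub>R axis j 1) - h (x + s *\<^sub>R axis i 1) - h (x + s *\<^sub>R axis j 1) + h x"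
  have "norm (D - (s * s) *\<^sub>R ?b) \<le> s * s * e" "norm (D - (s * s) *\<^sub>R ?a) \<le> s * s * e"
    using d1(2)[OF s(1,2)] d2(2)[OF s(1,3)] by (simp_all add: D_def algebra_simps)
  then have "norm ((D - (s * s) *\<^sub>R ?b) - (D - (s * s) *\<^sub>R ?a)) \<le> s * s * e + s * s * e"
    by (meson norm_triangle_ineq4 add_mono order_trans)
  moreover have "(D - (s * s) *\<^sub>R ?b) - (D - (s * s) *\<^sub>R ?a) = (s * s) *\<^sub>R (?a - ?b)"
    by (simp add: algebra_simps)
  ultimately have "norm ((s * s) *\<^sub>R (?a - ?b)) \<le> s * s * (2 * e)"
    by (simp only: mult_2 distrib_left)
  then have "s * s * norm (?a - ?b) \<le> s * s * (2 * e)"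
    using s by simp
  then have "norm (?a - ?b) \<le> 2 * e" using s by simp
  then show False using e by (simp add: e_def)
qed

section \<open>Iterated partial derivatives and multi-indices\<close>

lemma Ck_open_partially_differentiable:
  "Ck_open k U g \<Longrightarrow> length ds < k \<Longrightarrow> partially_differentiable_on (Dlist ds g) U"
  by (simp add: Ck_open_def partially_differentiable_on_def)

lemma Ck_open_continuous:
  "Ck_open k U g \<Longrightarrow> length ds \<le> k \<Longrightarrow> continuous_on U (Dlist ds g)"
  by (simp add: Ck_open_def uniformly_continuous_imp_continuous)

text \<open>\<open>i\<close> passes the entries of \<open>ds1\<close> one at a time by Schwarz's
  theorem. The strict bound leaves room for \<open>i\<close>, so that every derivative met has order
  at most \<open>k\<close>.\<close>

lemma Dlist_move:
  assumes U: "open U" and C: "Ck_open k U g" and "length ds1 + length ds2 < k" "x \<in> U"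
  shows "Dlist (i # ds1 @ ds2) g x = Dlist (ds1 @ i # ds2) g x"
  using assms(3,4)
proof (induction ds1 arbitrary: x)
  case (Cons j ds1)
  have len: "length (ds1 @ ds2) + 2 \<le> k" using Cons.prems by simp
  let ?h = "Dlist (ds1 @ ds2) g"
  have "pdiff i (pdiff j ?h) x = pdiff j (pdiff i ?h) x"
  proof (rule pdiff_commute[OF U Cons.prems(2)])
    show "partially_differentiable_on ?h U"
      using Ck_open_partially_differentiable[OF C, of "ds1 @ ds2"] len by simp
    show "partially_differentiable_on (pdiff i ?h) U" for i
      using Ck_open_partially_differentiable[OF C, of "i # ds1 @ ds2"] len by simp
    show "continuous_on U (pdiff j (pdiff i ?h))" for i j
      using Ck_open_continuous[OF C, of "j # i # ds1 @ ds2"] len by simp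
  qed
  also have "\<dots> = pdiff j (Dlist (ds1 @ i # ds2) g) x"
    using Cons by (intro pdiff_cong_on_open[OF U]) auto
  finally show ?case by simp
qed auto

definition mi_count :: "3 list \<Rightarrow> 3 \<Rightarrow> nat" where
  "mi_count ds i = count_list ds i"

lemma three_cases: "i = 0 \<or> i = 1 \<or> i = (2::3)"
  using exhaust_3[of i] by auto

lemma mi_order_count: "mi_order (mi_count ds) = length ds"
proof -
  have "(\<Sum>i\<in>UNIV. count_list ds i) = length ds"
    by (rule sum_count_set) auto
  then show ?thesis by (simp add: mi_order_def mi_count_def)
qed

lemma length_mi_list: "length (mi_list \<beta>) = mi_order \<beta>"
proof -
  \<comment> \<open>\<open>sum_3\<close> runs over 1, 2, 3 whereas \<open>mi_list\<close> uses 0, 1,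
    2; in the type \<open>3\<close> these are the same indices.\<close>
  have "(0::3) = 3" by simp
  then show ?thesis unfolding mi_list_def mi_order_def sum_3 by (metis (no_types) add.commute add.left_commute length_append length_replicate)
qed

text \<open>Insertion sort: the tail is sorted by induction, then the head is moved behind the
  smaller indices. This connects the arbitrary lists produced by the chain rule with the sorted
  derivatives in the norm.\<close>

lemma Dlist_eq_Dmi:
  assumes U: "open U" and C: "Ck_open k U g" and "length ds \<le> k" "x \<in> U"
  shows "Dlist ds g x = Dmi (mi_count ds) g x"
  using assms(3,4)
proof (induction ds arbitrary: x)
  case Nil
  then show ?case by (simp add: Dmi_def mi_list_def mi_count_def)
next
  case (Cons i ds)
  let ?b = "mi_count ds"
  have len: "?b 0 + ?b 1 + ?b 2 < k"
    using Cons.prems length_mi_list[of ?b] mi_order_count[of ds] by (simp add: mi_list_def)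
  have "Dlist (i # ds) g x = Dlist (i # mi_list ?b) g x"
    using Cons pdiff_cong_on_open[OF U, of x "Dlist ds g" "Dlist (mi_list ?b) g" i]
    by (simp add: Dmi_def)
  also have "\<dots> = Dlist (mi_list (mi_count (i # ds))) g x"
    using three_cases[of i]
  proof (elim disjE)
    assume "i = 0"
    then show ?thesis by (simp add: mi_list_def mi_count_def)
  next
    assume "i = 1"
    then show ?thesis
      using Dlist_move[OF U C, of "replicate (?b 0) 0" "replicate (?b 1) 1 @ replicate (?b 2) 2" x 1] len Cons.prems
      by (simp add: mi_list_def mi_count_def)
  next
    assume "i = 2"
    then show ?thesis
      using Dlist_move[OF U C, of "replicate (?b 0) 0 @ replicate (?b 1) 1" "replicate (?b 2) 2" x 2] len Cons.prems
      by (simp add: mi_list_def mi_count_def)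
  qed
  finally show ?case by (simp add: Dmi_def)
qed

section \<open>Finite differences and Hoelder classes on the line\<close>

text \<open>A single constant bounds all derivatives and the Hoelder quotient of the last one. The
  recursion strips one derivative at a time, which suits inductions by the product rule or the mean
  value inequality.\<close>

fun holder_class :: "real \<Rightarrow> nat \<Rightarrow> real \<Rightarrow> (real \<Rightarrow> complex) \<Rightarrow> bool" where
  "holder_class \<alpha> 0 B u \<longleftrightarrow>
     (\<forall>s. cmod (u s) \<le> B) \<and> (\<forall>s t. cmod (u s - u t) \<le> B * \<bar>s - t\<bar> powr \<alpha>)"
| "holder_class \<alpha> (Suc k) B u \<longleftrightarrow>
     (\<forall>s. cmod (u s) \<le> B) \<and>
     (\<exists>u'. (\<forall>s. (u has_vector_derivative u' s) (at s)) \<and> holder_class \<alpha> k B u')"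

lemma holder_class_bound: "holder_class \<alpha> k B u \<Longrightarrow> cmod (u s) \<le> B"
  by (cases k) auto

lemma holder_class_nonneg: "holder_class \<alpha> k B u \<Longrightarrow> 0 \<le> B"
  using holder_class_bound[of \<alpha> k B u 0] norm_ge_zero order_trans by blast

lemma holder_class_mono: "holder_class \<alpha> k B u \<Longrightarrow> B \<le> C \<Longrightarrow> holder_class \<alpha> k C u"
proof (induction k arbitrary: u)
  case 0
  then have "B * \<bar>s - t\<bar> powr \<alpha> \<le> C * \<bar>s - t\<bar> powr \<alpha>" for s t
    by (intro mult_right_mono) auto
  with 0 show ?case by (simp only: holder_class.simps) (blast intro: order_trans)
next
  case (Suc k)
  then show ?case by (auto intro: order_trans)
qed

lemma holder_class_add:
  "holder_class \<alpha> k B u \<Longrightarrow> holder_class \<alpha> k C v \<Longrightarrow> holder_class \<alpha> k (B + C) (\<lambda>s. u s + v s)"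
proof (induction k arbitrary: u v)
  case 0
  have "cmod (u s + v s - (u t + v t)) \<le> (B + C) * \<bar>s - t\<bar> powr \<alpha>" for s t
  proof -
    have "u s + v s - (u t + v t) = (u s - u t) + (v s - v t)" by simp
    also have "cmod \<dots> \<le> B * \<bar>s - t\<bar> powr \<alpha> + C * \<bar>s - t\<bar> powr \<alpha>"
      using 0 by (intro norm_triangle_mono) auto
    finally show ?thesis by (simp add: distrib_right)
  qed
  then show ?case using 0 by (auto intro: norm_triangle_mono)
next
  case (Suc k)
  then obtain u' v' where
    "\<And>s. (u has_vector_derivative u' s) (at s)" "holder_class \<alpha> k B u'"
    "\<And>s. (v has_vector_derivative v' s) (at s)" "holder_class \<alpha> k C v'" by auto
  then have "(\<forall>s. ((\<lambda>s. u s + v s) has_vector_derivative (u' s + v' s)) (at s)) \<and>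
      holder_class \<alpha> k (B + C) (\<lambda>s. u' s + v' s)"
    using Suc.IH by (auto intro: has_vector_derivative_add)
  then show ?case using Suc.prems by (auto intro: norm_triangle_mono)
qed

text \<open>Interpolates between a Lipschitz estimate, used for \<open>d \<le> 1\<close> where
  \<open>d \<le> d powr \<alpha>\<close>, and a uniform bound, used for \<open>d > 1\<close> where
  \<open>1 \<le> d powr \<alpha>\<close>.\<close>

lemma le_mult_powr:
  fixes a :: real
  assumes "0 < \<alpha>" "\<alpha> \<le> 1" "0 \<le> d" "a \<le> L * d" "a \<le> L" "0 \<le> L"
  shows "a \<le> L * d powr \<alpha>"
proof (cases "d \<le> 1")
  case True
  have "d \<le> d powr \<alpha>"
  proof (cases "d = 0")
    case False
    then have "d powr 1 \<le> d powr \<alpha>" using True assms by (intro powr_mono') auto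
    then show ?thesis using False assms by simp
  qed auto
  then show ?thesis using assms(4,6) mult_left_mono[of d "d powr \<alpha>" L] by linarith
next
  case False
  then have "1 \<le> d powr \<alpha>" using assms by (intro ge_one_powr_ge_zero) auto
  then show ?thesis using assms(5,6) mult_left_mono[of 1 "d powr \<alpha>" L] by linarith
qed

lemma vector_derivative_bound_diff:
  fixes f :: "real \<Rightarrow> 'b::real_normed_vector"
  assumes "\<And>t. (f has_vector_derivative f' t) (at t)" "\<And>t. norm (f' t) \<le> B"
  shows "norm (f s - f t) \<le> B * \<bar>s - t\<bar>"
  using vector_derivative_linear_approx[of t s f f' 0 B] assms by (simp add: mult.commute)

text \<open>A bounded function with bounded derivative is Hoelder by \<open>le_mult_powr\<close>.
  The 2 comes from bounding its oscillation by two sup norms.\<close>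

lemma holder_class_lower:
  assumes "0 < \<alpha>" "\<alpha> \<le> 1"
  shows "holder_class \<alpha> (Suc k) B u \<Longrightarrow> holder_class \<alpha> k (2 * B) u"
proof (induction k arbitrary: u)
  case 0
  then obtain u' where u': "\<And>s. (u has_vector_derivative u' s) (at s)" "holder_class \<alpha> 0 B u'"
    by auto
  have B: "\<And>s. cmod (u s) \<le> B" "0 \<le> B"
    using holder_class_bound[OF 0(1)] holder_class_nonneg[OF 0(1)] by auto
  have "cmod (u s - u t) \<le> (2 * B) * \<bar>s - t\<bar> powr \<alpha>" for s t
  proof (rule le_mult_powr[OF assms])
    have "cmod (u s - u t) \<le> B * \<bar>s - t\<bar>"
      using u' by (intro vector_derivative_bound_diff[of u u']) auto
    also have "\<dots> \<le> 2 * B * \<bar>s - t\<bar>" using B(2) by (intro mult_right_mono) auto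
    finally show "cmod (u s - u t) \<le> 2 * B * \<bar>s - t\<bar>" .
    show "cmod (u s - u t) \<le> 2 * B"
      using norm_triangle_ineq4[of "u s" "u t"] B(1)[of s] B(1)[of t] by linarith
  qed (use B in auto)
  moreover have "cmod (u s) \<le> 2 * B" for s using B(1)[of s] B(2) by linarith
  ultimately show ?case by auto
next
  case (Suc k)
  then obtain u' where u': "\<And>s. (u has_vector_derivative u' s) (at s)" "holder_class \<alpha> (Suc k) B u'"
    by auto
  have "cmod (u s) \<le> 2 * B" for s
    using holder_class_bound[OF Suc.prems, of s] holder_class_nonneg[OF Suc.prems] by linarith
  then show ?case using Suc.IH[OF u'(2)] u'(1) by auto
qed

lemma trig_bound:
  fixes a b s :: real
  assumes "\<bar>a\<bar> \<le> 1" "\<bar>b\<bar> \<le> 1"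
  shows "\<bar>a * cos s + b * sin s\<bar> \<le> 2"
proof -
  have "\<bar>a * cos s\<bar> \<le> 1 * 1" "\<bar>b * sin s\<bar> \<le> 1 * 1"
    unfolding abs_mult using assms by (intro mult_mono; simp)+
  then show ?thesis by linarith
qed

lemma trig_has_vector_derivative:
  "((\<lambda>s. a * cos s + b * sin s) has_vector_derivative (b * cos s + (- a) * sin s)) (at s)"
  by (auto intro!: derivative_eq_intros simp: has_real_derivative_iff_has_vector_derivative[symmetric])

text \<open>The 6 is 2, the bound of the trigonometric factor, plus 4, its Hoelder constant. In the
  product rule the term with \<open>u\<close> itself must first be lowered to class
  \<open>k\<close>, which costs 2, so each derivative multiplies the constant by 1 + 2 = 3. The
  derivative of the factor has coefficients \<open>b\<close> and \<open>- a\<close>, so the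
  induction hypothesis covers it too.\<close>

lemma holder_class_mult_trig:
  assumes "0 < \<alpha>" "\<alpha> \<le> 1"
  shows "holder_class \<alpha> k B u \<Longrightarrow> \<bar>a\<bar> \<le> 1 \<Longrightarrow> \<bar>b\<bar> \<le> 1 \<Longrightarrow>
    holder_class \<alpha> k (6 * 3 ^ k * B) (\<lambda>s. (a * cos s + b * sin s) *\<^sub>R u s)"
proof (induction k arbitrary: u a b B)
  case 0
  let ?w = "\<lambda>s. a * cos s + b * sin s"
  have B: "\<And>s. cmod (u s) \<le> B" "0 \<le> B"
    using holder_class_bound[OF 0(1)] holder_class_nonneg[OF 0(1)] by auto
  have w: "\<bar>?w s\<bar> \<le> 2" for s using trig_bound 0 by blast
  have wl: "\<bar>?w s - ?w t\<bar> \<le> 4 * \<bar>s - t\<bar> powr \<alpha>" for s t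
  proof (rule le_mult_powr[OF assms])
    have "norm (?w s - ?w t) \<le> 2 * \<bar>s - t\<bar>"
      using trig_bound[of b "-a"] 0 by (intro vector_derivative_bound_diff[OF trig_has_vector_derivative]) auto
    then show "\<bar>?w s - ?w t\<bar> \<le> 4 * \<bar>s - t\<bar>" by auto
    show "\<bar>?w s - ?w t\<bar> \<le> 4" using w[of s] w[of t] by linarith
  qed auto
  have bd: "cmod (?w s *\<^sub>R u s) \<le> 2 * B" for s
    using w[of s] B mult_mono[of "\<bar>?w s\<bar>" 2 "cmod (u s)" B] by simp
  have "cmod (?w s *\<^sub>R u s - ?w t *\<^sub>R u t) \<le> (6 * B) * \<bar>s - t\<bar> powr \<alpha>" for s t
  proof -
    have "?w s *\<^sub>R u s - ?w t *\<^sub>R u t = ?w s *\<^sub>R (u s - u t) + (?w s - ?w t) *\<^sub>R u t"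
      by (simp add: algebra_simps)
    also have "cmod \<dots> \<le> 2 * (B * \<bar>s - t\<bar> powr \<alpha>) + (4 * \<bar>s - t\<bar> powr \<alpha>) * B"
      unfolding norm_scaleR using 0 w wl B
      by (intro norm_triangle_mono; unfold norm_scaleR) (intro mult_mono; auto)+
    finally show ?thesis by (simp add: algebra_simps)
  qed
  moreover have "cmod (?w s *\<^sub>R u s) \<le> 6 * B" for s using bd[of s] B(2) by linarith
  ultimately show ?case by simp
next
  case (Suc k)
  let ?w = "\<lambda>s. a * cos s + b * sin s" and ?w' = "\<lambda>s. b * cos s + (- a) * sin s"
  obtain u' where u': "\<And>s. (u has_vector_derivative u' s) (at s)" "holder_class \<alpha> k B u'"
    using Suc.prems(1) by auto
  have B: "\<And>s. cmod (u s) \<le> B" "0 \<le> B"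
    using holder_class_bound[OF Suc.prems(1)] holder_class_nonneg[OF Suc.prems(1)] by auto
  have "cmod (?w s *\<^sub>R u s) \<le> 6 * 3 ^ Suc k * B" for s
  proof -
    have "cmod (?w s *\<^sub>R u s) \<le> 2 * B"
      using trig_bound[OF Suc.prems(2,3), of s] B mult_mono[of "\<bar>?w s\<bar>" 2 "cmod (u s)" B] by simp
    also have "\<dots> \<le> 6 * 3 ^ Suc k * B"
    proof (rule mult_right_mono[OF _ B(2)])
      show "2 \<le> 6 * (3::real) ^ Suc k" using one_le_power[of "3::real" "Suc k"] by linarith
    qed
    finally show ?thesis .
  qed
  moreover have "((\<lambda>s. ?w s *\<^sub>R u s) has_vector_derivative (?w s *\<^sub>R u' s + ?w' s *\<^sub>R u s)) (at s)" for s
    using has_vector_derivative_scaleR[of ?w "?w' s" s UNIV u "u' s"] u'(1)[of s]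
      trig_has_vector_derivative[of a b s]
    by (simp add: has_real_derivative_iff_has_vector_derivative)
  moreover have "holder_class \<alpha> k (6 * 3 ^ Suc k * B) (\<lambda>s. ?w s *\<^sub>R u' s + ?w' s *\<^sub>R u s)"
  proof -
    have "holder_class \<alpha> k (6 * 3 ^ k * B) (\<lambda>s. ?w s *\<^sub>R u' s)"
      by (rule Suc.IH[OF u'(2) Suc.prems(2,3)])
    moreover have "holder_class \<alpha> k (6 * 3 ^ k * (2 * B)) (\<lambda>s. ?w' s *\<^sub>R u s)"
      using Suc.prems(2,3) by (intro Suc.IH[OF holder_class_lower[OF assms Suc.prems(1)]]) auto
    ultimately have "holder_class \<alpha> k (6 * 3 ^ k * B + 6 * 3 ^ k * (2 * B)) (\<lambda>s. ?w s *\<^sub>R u' s + ?w' s *\<^sub>R u s)"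
      by (rule holder_class_add)
    then show ?thesis by (simp add: algebra_simps)
  qed
  ultimately show ?case unfolding holder_class.simps
    by (intro conjI allI exI[of _ "\<lambda>s. ?w s *\<^sub>R u' s + ?w' s *\<^sub>R u s"]) auto
qed

section \<open>Forward differences\<close>

definition fdiff :: "'a::plus \<Rightarrow> ('a \<Rightarrow> complex) \<Rightarrow> 'a \<Rightarrow> complex" where
  "fdiff v g x = g (x + v) - g x"

lemma fdiff_has_vector_derivative:
  assumes "\<And>s. (u has_vector_derivative u' s) (at s)"
  shows "((fdiff t ^^ m) u has_vector_derivative (fdiff t ^^ m) u' s) (at s)"
proof (induction m arbitrary: s)
  case (Suc m)
  let ?f = "(fdiff t ^^ m) u" and ?f' = "(fdiff t ^^ m) u'"
  have "((?f \<circ> (\<lambda>s. s + t)) has_vector_derivative (1 *\<^sub>R ?f' (s + t))) (at s)"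
    by (intro vector_diff_chain_at Suc.IH) (auto intro!: derivative_eq_intros)
  then have "((\<lambda>s. ?f (s + t) - ?f s) has_vector_derivative (?f' (s + t) - ?f' s)) (at s)"
    using Suc.IH by (intro has_vector_derivative_diff) (auto simp: o_def)
  then show ?case by (simp add: fdiff_def[abs_def])
qed (use assms in auto)

text \<open>Differencing commutes with differentiation. By the mean value inequality
  \<open>k\<close> of the differences are traded for derivatives, each with a factor
  \<open>t\<close>; the remaining one meets the Hoelder bound and yields
  \<open>t powr \<alpha>\<close>.\<close>

lemma holder_class_fdiff_bound:
  assumes "t > 0"
  shows "holder_class \<alpha> k B u \<Longrightarrow> cmod ((fdiff t ^^ Suc k) u s) \<le> B * t powr (real k + \<alpha>)"
proof (induction k arbitrary: u s)
  case 0
  then have "cmod (u (s + t) - u s) \<le> B * \<bar>(s + t) - s\<bar> powr \<alpha>" by (simp only: holder_class.simps)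
  then show ?case using assms by (simp add: fdiff_def)
next
  case (Suc k)
  then obtain u' where u': "\<And>s. (u has_vector_derivative u' s) (at s)" "holder_class \<alpha> k B u'"
    by auto
  have "cmod ((fdiff t ^^ Suc k) u (s + t) - (fdiff t ^^ Suc k) u s) \<le> (B * t powr (real k + \<alpha>)) * \<bar>(s + t) - s\<bar>"
    using fdiff_has_vector_derivative[OF u'(1)] Suc.IH[OF u'(2)]
    by (rule vector_derivative_bound_diff)
  also have "\<dots> = B * (t powr 1 * t powr (real k + \<alpha>))" using assms by simp
  also have "\<dots> = B * t powr (real (Suc k) + \<alpha>)"
    unfolding powr_add[symmetric] by (simp add: algebra_simps)
  finally show ?case
    by (simp only: funpow.simps(2)[of "Suc k"] o_def fdiff_def[of t "(fdiff t ^^ Suc k) u"])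
qed

section \<open>Regularity along circles\<close>

definition circle_curve :: "real^3 \<Rightarrow> real^3 \<Rightarrow> real^3 \<Rightarrow> real \<Rightarrow> real^3" where
  "circle_curve p u v s = p + cos s *\<^sub>R u + sin s *\<^sub>R v"

lemma circle_curve_has_vector_derivative:
  "(circle_curve p u v has_vector_derivative (cos s *\<^sub>R v + (- sin s) *\<^sub>R u)) (at s)"
  unfolding circle_curve_def[abs_def]
  by (auto intro!: derivative_eq_intros)

lemma circle_curve_Lipschitz:
  assumes "norm u \<le> 1" "norm v \<le> 1"
  shows "norm (circle_curve p u v s - circle_curve p u v t) \<le> 2 * \<bar>s - t\<bar>"
proof (rule vector_derivative_bound_diff[OF circle_curve_has_vector_derivative])
  fix s
  have "norm (cos s *\<^sub>R v) \<le> 1 * 1" "norm ((- sin s) *\<^sub>R u) \<le> 1 * 1"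
    unfolding norm_scaleR using assms by (intro mult_mono; simp)+
  then have "norm (cos s *\<^sub>R v + - sin s *\<^sub>R u) \<le> 1 + 1"
    by (intro norm_triangle_mono) auto
  then show "norm (cos s *\<^sub>R v + - sin s *\<^sub>R u) \<le> 2" by simp
qed

text \<open>The velocity components have exactly the form of the factor in
  \<open>holder_class_mult_trig\<close>.\<close>

lemma has_vector_derivative_comp_circle_curve:
  assumes "open U" "Ck_open (Suc k) U g" "length ds \<le> k" "circle_curve p u v s \<in> U"
  shows "((\<lambda>s. Dlist ds g (circle_curve p u v s)) has_vector_derivative
     (\<Sum>i\<in>UNIV. (v $ i * cos s + (- u $ i) * sin s) *\<^sub>R pdiff i (Dlist ds g) (circle_curve p u v s))) (at s)"
proof -
  let ?h = "Dlist ds g"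
  have "(?h has_derivative (\<lambda>w. \<Sum>i\<in>UNIV. (w $ i) *\<^sub>R pdiff i ?h (circle_curve p u v s))) (at (circle_curve p u v s))"
    using assms Ck_open_partially_differentiable[of "Suc k" U g ds] Ck_open_continuous[of "Suc k" U g "_ # ds"]
    by (intro has_derivative_continuous_partials[of U]) auto
  from vector_derivative_diff_chain_within[OF circle_curve_has_vector_derivative, OF has_derivative_at_withinI[OF this]]
  show ?thesis by (simp add: o_def mult.commute)
qed

text \<open>Induction on the number \<open>k - length ds\<close> of derivatives still available. The
  chain rule gives three trigonometric multiples of derivatives of the next order; three times
  \<open>6 * 3 ^ m\<close> is at most \<open>18 * 3 ^ k\<close>, paid at each of \<open>k\<close>
  levels. The Hoelder hypothesis is phrased in the parameter of the curve, so that for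
  \<open>\<alpha> = 1\<close> it can come from a mean value argument along the circle.\<close>

lemma holder_class_comp_circle_curve:
  assumes \<alpha>: "0 < \<alpha>" "\<alpha> \<le> 1" and U: "open U"
    and uv: "norm u \<le> 1" "norm v \<le> 1" and curve: "\<And>s. circle_curve p u v s \<in> U"
    and "Ck_open k U g"
    and "\<And>ds s. length ds \<le> k \<Longrightarrow> cmod (Dlist ds g (circle_curve p u v s)) \<le> B"
    and "\<And>ds s t. length ds = k \<Longrightarrow>
       cmod (Dlist ds g (circle_curve p u v s) - Dlist ds g (circle_curve p u v t)) \<le> B * \<bar>s - t\<bar> powr \<alpha>"
    and "B \<ge> 0"
  shows "holder_class \<alpha> k ((18 * 3 ^ k) ^ k * B) (\<lambda>s. g (circle_curve p u v s))"
proof -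
  have "holder_class \<alpha> (k - length ds) ((18 * 3 ^ k) ^ (k - length ds) * B) (\<lambda>s. Dlist ds g (circle_curve p u v s))"
    if "length ds \<le> k" for ds
    using that
  proof (induction "k - length ds" arbitrary: ds)
    case 0
    then have "length ds = k" by simp
    then show ?case using assms by simp
  next
    case (Suc m)
    then have m: "k - length ds = Suc m" "length ds < k" by auto
    let ?C = "(18 * 3 ^ k) ^ m * B" and ?\<gamma> = "circle_curve p u v"
    have IH: "holder_class \<alpha> m ?C (\<lambda>s. pdiff i (Dlist ds g) (?\<gamma> s))" for i
    proof -
      have e: "m = k - length (i # ds)" using m by simp
      then show ?thesis using Suc.hyps(1)[OF e] m by simp
    qed
    have C0: "?C \<ge> 0" using assms by simp
    have comp: "\<bar>u $ i\<bar> \<le> 1" "\<bar>v $ i\<bar> \<le> 1" for i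
      using uv component_le_norm_cart[of u i] component_le_norm_cart[of v i] by linarith+
    let ?d = "\<lambda>i s. (v $ i * cos s + (- u $ i) * sin s) *\<^sub>R pdiff i (Dlist ds g) (?\<gamma> s)"
    have "holder_class \<alpha> m (6 * 3 ^ m * ?C) (?d i)" for i
      using comp by (intro holder_class_mult_trig[OF \<alpha> IH]) auto
    then have "holder_class \<alpha> m (6 * 3 ^ m * ?C + 6 * 3 ^ m * ?C + 6 * 3 ^ m * ?C) (\<lambda>s. ?d 1 s + ?d 2 s + ?d 3 s)"
      by (intro holder_class_add) auto
    then have "holder_class \<alpha> m (18 * 3 ^ m * ?C) (\<lambda>s. \<Sum>i\<in>UNIV. ?d i s)"
      unfolding sum_3 by (simp add: algebra_simps)
    moreover have "18 * 3 ^ m * ?C \<le> (18 * 3 ^ k) * ?C"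
      using m C0 by (intro mult_right_mono) (auto intro!: power_increasing)
    ultimately have 1: "holder_class \<alpha> m ((18 * 3 ^ k) ^ Suc m * B) (\<lambda>s. \<Sum>i\<in>UNIV. ?d i s)"
      by (auto intro: holder_class_mono simp: mult.assoc)
    have 2: "((\<lambda>s. Dlist ds g (?\<gamma> s)) has_vector_derivative (\<Sum>i\<in>UNIV. ?d i s)) (at s)" for s
    proof -
      have "Ck_open (Suc (k - 1)) U g" using assms m by simp
      from has_vector_derivative_comp_circle_curve[OF U this, of ds] show ?thesis using m curve by simp
    qed
    have 3: "cmod (Dlist ds g (?\<gamma> s)) \<le> (18 * 3 ^ k) ^ Suc m * B" for s
    proof -
      have "cmod (Dlist ds g (?\<gamma> s)) \<le> 1 * B" using assms m by simp
      also have "\<dots> \<le> (18 * 3 ^ k) ^ Suc m * B"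
      proof -
        have "(1::real) \<le> 18 * 3 ^ k" using one_le_power[of "3::real" k] by linarith
        then show ?thesis using assms by (intro mult_right_mono one_le_power) auto
      qed
      finally show ?thesis .
    qed
    show ?case unfolding m(1) holder_class.simps
      by (intro conjI allI exI[of _ "\<lambda>s. \<Sum>i\<in>UNIV. ?d i s"] 1 2 3)
  qed
  from this[of "[]"] show ?thesis by simp
qed

section \<open>Fourier coefficients on the torus\<close>

text \<open>Normalised so that the exponentials \<open>cis (ip n x)\<close> are orthonormal. The
  square is fixed; invariance under shifts comes later, from approximation.\<close>

definition torus_mean :: "(real \<times> real \<Rightarrow> complex) \<Rightarrow> complex" where
  "torus_mean g = complex_of_real (1 / (2 * pi)^2) * integral (cbox (0, 0) (2 * pi, 2 * pi)) g"

lemma continuous_on_ip [continuous_intros]: "continuous_on S (ip n)"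
  unfolding ip_def by (intro continuous_intros)

lemma continuous_on_cis_ip [continuous_intros]: "continuous_on S (\<lambda>x. cis (ip n x))"
  by (intro continuous_on_cis continuous_intros)

lemma ip_add: "ip n (x + y) = ip n x + ip n y"
  by (simp add: ip_def algebra_simps)

lemma ip_diff: "ip (n - m) x = ip n x - ip m x"
  by (simp add: ip_def algebra_simps)

lemma ip_add_left: "ip (n + m) x = ip n x + ip m x"
  by (simp add: ip_def algebra_simps)

lemma torus_integrable:
  fixes g :: "real \<times> real \<Rightarrow> 'a::banach"
  shows "continuous_on UNIV g \<Longrightarrow> g integrable_on cbox (0, 0) (2 * pi, 2 * pi)"
  by (meson integrable_continuous continuous_on_subset subset_UNIV)

lemma torus_mean_add:
  "continuous_on UNIV g \<Longrightarrow> continuous_on UNIV h \<Longrightarrow>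
   torus_mean (\<lambda>x. g x + h x) = torus_mean g + torus_mean h"
  unfolding torus_mean_def by (simp add: integral_add torus_integrable add_divide_distrib)

lemma torus_mean_diff:
  "continuous_on UNIV g \<Longrightarrow> continuous_on UNIV h \<Longrightarrow>
   torus_mean (\<lambda>x. g x - h x) = torus_mean g - torus_mean h"
  unfolding torus_mean_def by (simp add: integral_diff torus_integrable diff_divide_distrib)

lemma torus_mean_cmult: "torus_mean (\<lambda>x. c * g x) = c * torus_mean g"
  unfolding torus_mean_def by (simp add: algebra_simps)

lemma torus_mean_sum:
  "finite F \<Longrightarrow> (\<And>n. n \<in> F \<Longrightarrow> continuous_on UNIV (g n)) \<Longrightarrow>
   torus_mean (\<lambda>x. \<Sum>n\<in>F. g n x) = (\<Sum>n\<in>F. torus_mean (g n))"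
  unfolding torus_mean_def by (simp add: integral_sum torus_integrable sum_distrib_left)

lemma torus_mean_cnj: "torus_mean (\<lambda>x. cnj (g x)) = cnj (torus_mean g)"
  unfolding torus_mean_def by (simp add: integral_cnj)

lemma content_torus_box: "measure lborel (cbox (0::real, 0::real) (2 * pi, 2 * pi)) = (2 * pi)^2"
  by (simp add: content_Pair power2_eq_square)

lemma norm_torus_mean_le:
  assumes "continuous_on UNIV g" "\<And>x. cmod (g x) \<le> B"
  shows "cmod (torus_mean g) \<le> B"
proof -
  have "0 \<le> B" using assms(2)[of undefined] norm_ge_zero order_trans by blast
  then have "cmod (integral (cbox (0,0) (2*pi, 2*pi)) g) \<le> B * measure lborel (cbox (0::real, 0::real) (2 * pi, 2 * pi))"
    using torus_integrable[OF assms(1)] assms(2)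
    by (intro has_integral_bound[of B g]) (auto simp: integrable_integral)
  then show ?thesis unfolding content_torus_box torus_mean_def
    by (simp add: norm_mult norm_divide norm_power field_simps)
qed

lemma integral_cis_period:
  "integral {0..2*pi} (\<lambda>y. cis (of_int m * y)) = (if m = 0 then complex_of_real (2 * pi) else 0)"
proof (cases "m = 0")
  case False
  have "((\<lambda>y. cis (of_int m * y)) has_integral
      (cis (of_int m * (2*pi)) / (\<i> * of_int m) - cis (of_int m * 0) / (\<i> * of_int m))) {0..2*pi}"
  proof (rule fundamental_theorem_of_calculus)
    fix y :: real
    have "((\<lambda>y. exp (\<i> * (of_int m * of_real y)) / (\<i> * of_int m)) has_vector_derivative
       exp (\<i> * (of_int m * of_real y))) (at y within {0..2*pi})"
      using False by (intro has_vector_derivative_real_field)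
        (auto intro!: derivative_eq_intros simp: field_simps)
    then show "((\<lambda>y. cis (of_int m * y) / (\<i> * of_int m)) has_vector_derivative cis (of_int m * y)) (at y within {0..2*pi})"
      by (simp add: cis_conv_exp)
  qed auto
  moreover have "cis (of_int m * (2*pi)) = 1"
    by (metis cis_multiple_2pi Ints_of_int mult.commute mult.assoc)
  ultimately show ?thesis using False by (simp add: integral_unique)
qed (simp add: scaleR_conv_of_real)

lemma torus_mean_cis: "torus_mean (\<lambda>x. cis (ip n x)) = (if n = 0 then 1 else 0)"
proof -
  have "integral (cbox (0, 0) (2*pi, 2*pi)) (\<lambda>x. cis (ip n x)) =
     integral {0..2*pi} (\<lambda>x. integral {0..2*pi} (\<lambda>y. cis (of_int (fst n) * x) * cis (of_int (snd n) * y)))"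
    by (subst integral_prod_continuous) (auto intro!: continuous_intros simp: ip_def cis_mult)
  also have "\<dots> = (if fst n = 0 then complex_of_real (2 * pi) else 0) * (if snd n = 0 then complex_of_real (2 * pi) else 0)"
    by (simp only: integral_mult_right integral_mult_left integral_cis_period)
  finally show ?thesis unfolding torus_mean_def
    by (cases n) (auto simp: power2_eq_square zero_prod_def)
qed

lemma fourier_coeff_eq_torus_mean: "fourier_coeff g n = torus_mean (\<lambda>x. g x * cis (- ip n x))"
  unfolding fourier_coeff_def torus_mean_def by (simp add: cis_conv_exp)

lemma continuous_on_mult_cis_ip:
  "continuous_on S g \<Longrightarrow> continuous_on S (\<lambda>x. g x * cis (- ip n x))"
  by (intro continuous_on_mult continuous_on_cis continuous_on_minus continuous_on_ip)

lemma norm_fourier_coeff_le: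
  assumes "continuous_on UNIV g" "\<And>x. cmod (g x) \<le> B"
  shows "cmod (fourier_coeff g n) \<le> B"
  unfolding fourier_coeff_eq_torus_mean
  using assms by (intro norm_torus_mean_le continuous_on_mult_cis_ip) (auto simp: norm_mult)

lemma fourier_coeff_add:
  assumes "continuous_on UNIV g" "continuous_on UNIV h"
  shows "fourier_coeff (\<lambda>x. g x + h x) n = fourier_coeff g n + fourier_coeff h n"
  unfolding fourier_coeff_eq_torus_mean distrib_right
  using assms by (intro torus_mean_add continuous_on_mult_cis_ip)

lemma fourier_coeff_diff:
  assumes "continuous_on UNIV g" "continuous_on UNIV h"
  shows "fourier_coeff (\<lambda>x. g x - h x) n = fourier_coeff g n - fourier_coeff h n"
  unfolding fourier_coeff_eq_torus_mean left_diff_distrib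
  using assms by (intro torus_mean_diff continuous_on_mult_cis_ip)

lemma fourier_coeff_cis:
  "fourier_coeff (\<lambda>x. c * cis (ip m x)) n = (if n = m then c else 0)"
proof -
  have "fourier_coeff (\<lambda>x. c * cis (ip m x)) n = torus_mean (\<lambda>x. c * cis (ip (m - n) x))"
    unfolding fourier_coeff_eq_torus_mean by (simp add: ip_diff cis_mult mult.assoc)
  then show ?thesis by (simp add: torus_mean_cmult torus_mean_cis)
qed

lemma fourier_coeff_sum:
  assumes "finite F"
  shows "fourier_coeff (\<lambda>x. \<Sum>m\<in>F. c m * cis (ip m x)) n = (if n \<in> F then c n else 0)"
proof -
  have "fourier_coeff (\<lambda>x. \<Sum>m\<in>F. c m * cis (ip m x)) n
      = (\<Sum>m\<in>F. fourier_coeff (\<lambda>x. c m * cis (ip m x)) n)"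
    unfolding fourier_coeff_eq_torus_mean sum_distrib_right
    using assms by (intro torus_mean_sum continuous_on_mult_cis_ip continuous_intros)
  also have "\<dots> = (if n \<in> F then c n else 0)"
    unfolding fourier_coeff_cis using assms by (simp add: sum.delta')
  finally show ?thesis .
qed

lemma torus_mean_norm_sq:
  assumes "continuous_on UNIV g"
  shows "torus_mean (\<lambda>x. g x * cnj (g x)) =
    complex_of_real (integral (cbox (0, 0) (2 * pi, 2 * pi)) (\<lambda>x. (cmod (g x))\<^sup>2) / (2 * pi)^2)"
proof -
  have "((\<lambda>x. complex_of_real ((cmod (g x))\<^sup>2)) has_integral
      complex_of_real (integral (cbox (0, 0) (2 * pi, 2 * pi)) (\<lambda>x. (cmod (g x))\<^sup>2))) (cbox (0, 0) (2 * pi, 2 * pi))"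
    using assms by (intro has_integral_of_real integrable_integral torus_integrable continuous_intros)
  then show ?thesis unfolding torus_mean_def complex_norm_square[symmetric]
    by (simp add: integral_unique del: of_real_power)
qed

text \<open>With \<open>q\<close> the partial sum over \<open>F\<close>, the mean of the squared
  modulus of \<open>g - q\<close> is nonnegative, and expanding it gives the mean of that of
  \<open>g\<close> minus \<open>S\<close>. The sup bound \<open>B\<close> stands in for the L2
  norm.\<close>

lemma Bessel_inequality:
  assumes g: "continuous_on UNIV g" and F: "finite F" and B: "\<And>x. cmod (g x) \<le> B"
  shows "(\<Sum>n\<in>F. (cmod (fourier_coeff g n))\<^sup>2) \<le> B\<^sup>2"
proof -
  define c where "c = fourier_coeff g"
  define q where "q = (\<lambda>x. \<Sum>n\<in>F. c n * cis (ip n x))"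
  define S where "S = (\<Sum>n\<in>F. (cmod (c n))\<^sup>2)"
  have q: "continuous_on UNIV q" unfolding q_def by (intro continuous_intros)
  have cq: "cnj (q x) = (\<Sum>n\<in>F. cnj (c n) * cis (- ip n x))" for x
    by (simp add: q_def cis_cnj)
  have gq: "torus_mean (\<lambda>x. h x * cnj (q x)) = (\<Sum>n\<in>F. cnj (c n) * fourier_coeff h n)"
    if h: "continuous_on UNIV h" for h
  proof -
    have "torus_mean (\<lambda>x. h x * cnj (q x)) = torus_mean (\<lambda>x. \<Sum>n\<in>F. cnj (c n) * (h x * cis (- ip n x)))"
      by (simp add: cq sum_distrib_left mult_ac)
    also have "\<dots> = (\<Sum>n\<in>F. torus_mean (\<lambda>x. cnj (c n) * (h x * cis (- ip n x))))"
      using F h by (intro torus_mean_sum continuous_on_mult_left continuous_on_mult_cis_ip)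
    finally show ?thesis by (simp add: torus_mean_cmult fourier_coeff_eq_torus_mean)
  qed
  \<comment> \<open>All three inner products that involve \<open>q\<close> equal
    \<open>S\<close>.\<close>
  have 1: "torus_mean (\<lambda>x. g x * cnj (q x)) = of_real S"
    unfolding gq[OF g] S_def c_def by (simp add: complex_norm_square mult.commute del: of_real_power)
  have 2: "torus_mean (\<lambda>x. q x * cnj (q x)) = of_real S"
  proof -
    have "torus_mean (\<lambda>x. q x * cnj (q x)) = (\<Sum>n\<in>F. cnj (c n) * c n)"
      unfolding gq[OF q] using fourier_coeff_sum[OF F, of c] by (simp add: q_def)
    then show ?thesis by (simp add: S_def complex_norm_square mult.commute del: of_real_power)
  qed
  have 3: "torus_mean (\<lambda>x. q x * cnj (g x)) = of_real S"
    using arg_cong[OF 1, of cnj] by (simp add: torus_mean_cnj[symmetric] mult.commute)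
  have "torus_mean (\<lambda>x. (g x - q x) * cnj (g x - q x)) =
      torus_mean (\<lambda>x. (g x * cnj (g x) - g x * cnj (q x)) - (q x * cnj (g x) - q x * cnj (q x)))"
    by (simp add: algebra_simps)
  also have "\<dots> = (torus_mean (\<lambda>x. g x * cnj (g x)) - of_real S) - (of_real S - of_real S)"
    using g q by (simp add: torus_mean_diff 1 2 3 continuous_intros)
  finally have "torus_mean (\<lambda>x. g x * cnj (g x)) =
      torus_mean (\<lambda>x. (g x - q x) * cnj (g x - q x)) + of_real S" by simp
  moreover have "0 \<le> Re (torus_mean (\<lambda>x. (g x - q x) * cnj (g x - q x)))"
    using g q by (subst torus_mean_norm_sq) (auto intro!: continuous_intros integral_nonneg divide_nonneg_nonneg torus_integrable)
  ultimately have "S \<le> Re (torus_mean (\<lambda>x. g x * cnj (g x)))" by simp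
  also have "\<dots> \<le> cmod (torus_mean (\<lambda>x. g x * cnj (g x)))" by (rule complex_Re_le_cmod)
  also have "\<dots> \<le> B\<^sup>2"
    using g B by (intro norm_torus_mean_le continuous_intros)
      (auto simp: norm_mult power2_eq_square intro: mult_mono order_trans[OF norm_ge_zero])
  finally show ?thesis by (simp add: S_def c_def)
qed

section \<open>Trigonometric polynomials and their uniform limits\<close>

inductive trigpoly :: "(real \<times> real \<Rightarrow> complex) \<Rightarrow> bool" where
  trigpoly_cis: "trigpoly (\<lambda>x. c * cis (ip n x))"
| trigpoly_add: "trigpoly p \<Longrightarrow> trigpoly q \<Longrightarrow> trigpoly (\<lambda>x. p x + q x)"

lemma trigpoly_const: "trigpoly (\<lambda>x. c)"
  using trigpoly_cis[of c 0] by (simp add: ip_def)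

lemma trigpoly_continuous: "trigpoly p \<Longrightarrow> continuous_on UNIV p"
  by (induction rule: trigpoly.induct) (intro continuous_intros; assumption)+

lemma trigpoly_mult:
  assumes "trigpoly p" "trigpoly q"
  shows "trigpoly (\<lambda>x. p x * q x)"
  using assms(1)
proof (induction rule: trigpoly.induct)
  case (trigpoly_cis c n)
  show ?case using assms(2)
  proof (induction rule: trigpoly.induct)
    case (trigpoly_cis d m)
    have "(\<lambda>x. c * cis (ip n x) * (d * cis (ip m x))) = (\<lambda>x. (c * d) * cis (ip (n + m) x))"
      by (simp add: ip_add_left cis_mult[symmetric] mult_ac fun_eq_iff)
    then show ?case using trigpoly.trigpoly_cis by simp
  next
    case (trigpoly_add p q)
    then show ?case using trigpoly.trigpoly_add by (simp add: distrib_left)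
  qed
next
  case (trigpoly_add p q)
  then show ?case using trigpoly.trigpoly_add by (simp add: distrib_right)
qed

lemma trigpoly_sum:
  assumes "finite F" shows "trigpoly (\<lambda>x. \<Sum>n\<in>F. c n * cis (ip n x))"
  using assms
proof (induction F)
  case empty then show ?case using trigpoly_const[of 0] by simp
next
  case (insert n F)
  then show ?case using trigpoly_add[OF trigpoly_cis[of "c n" n] insert.IH] by simp
qed

text \<open>Plays the part of "continuous and doubly periodic". Boundedness, periodicity and the
  rules for coefficients are read off from the approximating polynomials.\<close>

definition trig_approximable :: "(real \<times> real \<Rightarrow> complex) \<Rightarrow> bool" where
  "trig_approximable g \<longleftrightarrow> continuous_on UNIV g \<and>
     (\<forall>e>0. \<exists>p. trigpoly p \<and> (\<forall>x. cmod (g x - p x) \<le> e))"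

lemma trig_approximable_continuous: "trig_approximable g \<Longrightarrow> continuous_on UNIV g"
  by (simp add: trig_approximable_def)

text \<open>Both sides of an identity between Fourier coefficients depend continuously on the function in
  the sup norm, so it suffices to check it on exponentials.\<close>

lemma fourier_coeff_transform:
  assumes \<sigma>: "continuous_on UNIV \<sigma>"
    and exps: "\<And>m. fourier_coeff (\<lambda>x. cis (ip m (\<sigma> x))) n = \<kappa> * fourier_coeff (\<lambda>x. cis (ip m x)) n'"
    and g: "trig_approximable g"
  shows "fourier_coeff (\<lambda>x. g (\<sigma> x)) n = \<kappa> * fourier_coeff g n'"
proof -
  have contg: "continuous_on UNIV g" using g by (rule trig_approximable_continuous)
  have comp: "continuous_on UNIV (\<lambda>x. h (\<sigma> x))" if "continuous_on UNIV h" for h :: "real \<times> real \<Rightarrow> complex"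
    by (rule continuous_on_compose2[OF that \<sigma>]) auto
  have poly: "fourier_coeff (\<lambda>x. p (\<sigma> x)) n = \<kappa> * fourier_coeff p n'" if "trigpoly p" for p
    using that
  proof (induction rule: trigpoly.induct)
    case (trigpoly_cis c m)
    have "fourier_coeff (\<lambda>x. c * h x) k = c * fourier_coeff h k" for h k
      unfolding fourier_coeff_eq_torus_mean mult.assoc by (rule torus_mean_cmult)
    then show ?case using exps by simp
  next
    case (trigpoly_add p q)
    then show ?case
      by (simp add: fourier_coeff_add comp trigpoly_continuous distrib_left)
  qed
  have "cmod (fourier_coeff (\<lambda>x. g (\<sigma> x)) n - \<kappa> * fourier_coeff g n') \<le> 0 + e" if e: "e > 0" for e
  proof -
    define d where "d = e / (1 + cmod \<kappa>)"
    have pos: "1 + cmod \<kappa> > 0" by (rule add_pos_nonneg) auto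
    then have d: "d > 0" using e by (simp add: d_def)
    obtain p where p: "trigpoly p" "\<And>x. cmod (g x - p x) \<le> d" using g d by (auto simp: trig_approximable_def)
    note contp = trigpoly_continuous[OF p(1)]
    have 1: "cmod (fourier_coeff (\<lambda>x. g (\<sigma> x)) n - fourier_coeff (\<lambda>x. p (\<sigma> x)) n) \<le> d"
      unfolding fourier_coeff_diff[OF comp[OF contg] comp[OF contp], symmetric]
      by (intro norm_fourier_coeff_le comp continuous_on_diff contg contp p(2))
    have 2: "cmod (fourier_coeff g n' - fourier_coeff p n') \<le> d"
      using p(2) contp contg by (subst fourier_coeff_diff[symmetric])
        (auto intro!: norm_fourier_coeff_le continuous_on_diff)
    have "fourier_coeff (\<lambda>x. g (\<sigma> x)) n - \<kappa> * fourier_coeff g n' =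
        (fourier_coeff (\<lambda>x. g (\<sigma> x)) n - fourier_coeff (\<lambda>x. p (\<sigma> x)) n) - \<kappa> * (fourier_coeff g n' - fourier_coeff p n')"
      by (simp add: poly[OF p(1)] algebra_simps)
    also have "cmod \<dots> \<le> d + cmod \<kappa> * d"
      by (rule order_trans[OF norm_triangle_ineq4])
        (use 1 2 in \<open>intro add_mono; simp add: norm_mult mult_left_mono\<close>)
    also have "\<dots> = (1 + cmod \<kappa>) * d" by (simp add: distrib_right)
    also have "\<dots> = e" using pos by (simp add: d_def)
    finally show ?thesis by simp
  qed
  then have "cmod (fourier_coeff (\<lambda>x. g (\<sigma> x)) n - \<kappa> * fourier_coeff g n') \<le> 0"
    by (rule field_le_epsilon)
  then show ?thesis by simp
qed

lemma fourier_coeff_shift: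
  assumes "trig_approximable g"
  shows "fourier_coeff (\<lambda>x. g (x + v)) n = cis (ip n v) * fourier_coeff g n"
proof (rule fourier_coeff_transform[OF _ _ assms])
  fix m
  show "fourier_coeff (\<lambda>x. cis (ip m (x + v))) n = cis (ip n v) * fourier_coeff (\<lambda>x. cis (ip m x)) n"
    using fourier_coeff_cis[of "cis (ip m v)" m n] fourier_coeff_cis[of 1 m n]
    by (simp add: ip_add cis_mult[symmetric] mult.commute)
qed (intro continuous_intros)

text \<open>The substitution \<open>(a + pi, - b)\<close> turns the exponential of frequency
  \<open>m\<close> into \<open>(-1) powi fst m\<close> times that of \<open>Mref m\<close>. The
  resulting sign is the one built into \<open>dfs_e\<close>.\<close>

lemma fourier_coeff_Mref:
  assumes "trig_approximable g" and sym: "\<And>a b. g (a + pi, - b) = g (a, b)"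
  shows "fourier_coeff g (Mref n) = (-1) powi fst n * fourier_coeff g n"
proof -
  have 1: "cis (of_int j * pi) = (-1) powi j" for j
    using cis_power_int[of pi j] by simp
  have "fourier_coeff (\<lambda>x. g (fst x + pi, - snd x)) (Mref n) = (-1) powi fst n * fourier_coeff g n"
  proof (rule fourier_coeff_transform[OF _ _ assms(1)])
    fix m
    have "cis (ip m (fst x + pi, - snd x)) = (-1) powi (fst m) * cis (ip (Mref m) x)" for x
      by (simp add: 1[symmetric] cis_mult ip_def Mref_def algebra_simps)
    then have "fourier_coeff (\<lambda>x. cis (ip m (fst x + pi, - snd x))) (Mref n) =
        (if Mref n = Mref m then (-1) powi (fst m) else 0)"
      using fourier_coeff_cis[of "(-1) powi (fst m)" "Mref m" "Mref n"] by simp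
    also have "\<dots> = (-1) powi fst n * fourier_coeff (\<lambda>x. cis (ip m x)) n"
      using fourier_coeff_cis[of 1 m n] by (auto simp: Mref_def prod_eq_iff)
    finally show "fourier_coeff (\<lambda>x. cis (ip m (fst x + pi, - snd x))) (Mref n)
        = (-1) powi fst n * fourier_coeff (\<lambda>x. cis (ip m x)) n" .
  qed (intro continuous_intros)
  then show ?thesis using sym by simp
qed

lemma trig_approximable_diff:
  assumes "trig_approximable g" "trig_approximable h"
  shows "trig_approximable (\<lambda>x. g x - h x)"
  unfolding trig_approximable_def
proof (intro conjI allI impI)
  show "continuous_on UNIV (\<lambda>x. g x - h x)"
    using assms by (intro continuous_on_diff trig_approximable_continuous)
  fix e :: real assume "e > 0"
  then obtain p q where p: "trigpoly p" "\<And>x. cmod (g x - p x) \<le> e/2" and q: "trigpoly q" "\<And>x. cmod (h x - q x) \<le> e/2"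
    using assms half_gt_zero[of e] unfolding trig_approximable_def by meson
  have "trigpoly (\<lambda>x. p x + (- 1) * q x)"
    using p q by (intro trigpoly_add trigpoly_mult trigpoly_const)
  moreover have "cmod ((g x - h x) - (p x + (-1) * q x)) \<le> e" for x
  proof -
    have "(g x - h x) - (p x + (-1) * q x) = (g x - p x) - (h x - q x)" by simp
    also have "cmod \<dots> \<le> e/2 + e/2"
      by (rule order_trans[OF norm_triangle_ineq4]) (intro add_mono p q)
    finally show ?thesis by simp
  qed
  ultimately show "\<exists>p. trigpoly p \<and> (\<forall>x. cmod (g x - h x - p x) \<le> e)" by blast
qed

lemma trigpoly_shift: "trigpoly p \<Longrightarrow> trigpoly (\<lambda>x. p (x + v))"
proof (induction rule: trigpoly.induct)
  case (trigpoly_cis c n)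
  have "(\<lambda>x. c * cis (ip n (x + v))) = (\<lambda>x. (c * cis (ip n v)) * cis (ip n x))"
    by (simp add: ip_add cis_mult[symmetric] mult_ac fun_eq_iff)
  then show ?case using trigpoly.trigpoly_cis by simp
qed (rule trigpoly_add)

lemma trig_approximable_shift:
  assumes "trig_approximable g" shows "trig_approximable (\<lambda>x. g (x + v))"
proof -
  have "continuous_on UNIV (\<lambda>x. g (x + v))"
    by (rule continuous_on_compose2[OF trig_approximable_continuous[OF assms]]) (auto intro: continuous_intros)
  moreover have "\<exists>p. trigpoly p \<and> (\<forall>x. cmod (g (x + v) - p x) \<le> e)" if "e > 0" for e
    using assms that trigpoly_shift[of _ v] unfolding trig_approximable_def by meson
  ultimately show ?thesis unfolding trig_approximable_def by blast
qed

lemma trig_approximable_fdiff: "trig_approximable g \<Longrightarrow> trig_approximable ((fdiff v ^^ m) g)"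
  by (induction m) (auto simp: fdiff_def[abs_def] intro: trig_approximable_diff trig_approximable_shift)

lemma fourier_coeff_fdiff:
  fixes v :: "real \<times> real"
  assumes "trig_approximable g"
  shows "fourier_coeff ((fdiff v ^^ m) g) n = (cis (ip n v) - 1) ^ m * fourier_coeff g n"
proof (induction m)
  case (Suc m)
  note a = trig_approximable_fdiff[OF assms, where v = v and m = m]
  have "fourier_coeff ((fdiff v ^^ Suc m) g) n = fourier_coeff (\<lambda>x. (fdiff v ^^ m) g (x + v) - (fdiff v ^^ m) g x) n"
    by (simp add: fdiff_def[of v "(fdiff v ^^ m) g", abs_def])
  also have "\<dots> = cis (ip n v) * fourier_coeff ((fdiff v ^^ m) g) n - fourier_coeff ((fdiff v ^^ m) g) n"
    using a trig_approximable_shift[OF a]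
    by (simp add: fourier_coeff_diff trig_approximable_continuous fourier_coeff_shift)
  finally show ?case using Suc by (simp add: algebra_simps)
qed auto

lemma trigpoly_bounded: "trigpoly p \<Longrightarrow> \<exists>B. \<forall>x. cmod (p x) \<le> B"
proof (induction rule: trigpoly.induct)
  case (trigpoly_cis c n)
  then show ?case by (intro exI[of _ "cmod c"]) (simp add: norm_mult)
next
  case (trigpoly_add p q)
  then show ?case by (meson norm_triangle_mono)
qed

lemma trig_approximable_bounded:
  assumes "trig_approximable g"
  shows "\<exists>B. \<forall>x. cmod (g x) \<le> B"
proof -
  obtain p where p: "trigpoly p" "\<And>x. cmod (g x - p x) \<le> 1"
    using assms zero_less_one unfolding trig_approximable_def by meson
  obtain B where B: "\<And>x. cmod (p x) \<le> B" using trigpoly_bounded[OF p(1)] by blast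
  have "cmod (g x) \<le> 1 + B" for x
    using norm_triangle_mono[OF p(2)[of x] B[of x]] by simp
  then show ?thesis by blast
qed

lemma trigpoly_periodic:
  "trigpoly p \<Longrightarrow> p (x - (2 * pi * of_int i, 2 * pi * of_int j)) = p x"
proof (induction rule: trigpoly.induct)
  case (trigpoly_cis c n)
  have "ip n (x - (2 * pi * of_int i, 2 * pi * of_int j)) = ip n x - 2 * pi * of_int (fst n * i + snd n * j)"
    by (simp add: ip_def algebra_simps)
  moreover have "cis (ip n x - 2 * pi * of_int (fst n * i + snd n * j)) = cis (ip n x)"
    unfolding cis_divide[symmetric] by (subst cis_multiple_2pi) auto
  ultimately show ?case by simp
qed simp

text \<open>An approximating polynomial is exactly periodic, so a shift by multiples of
  \<open>2 * pi\<close> changes \<open>g\<close> by at most twice the approximation error. This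
  carries vanishing on the square over to the whole plane.\<close>

lemma trig_approximable_periodic:
  assumes "trig_approximable g"
  shows "\<exists>y\<in>cbox (0, 0) (2 * pi, 2 * pi). g y = g x"
proof -
  define w where "w = (2 * pi * of_int \<lfloor>fst x / (2 * pi)\<rfloor>, 2 * pi * of_int \<lfloor>snd x / (2 * pi)\<rfloor>)"
  have *: "0 \<le> a - 2 * pi * of_int \<lfloor>a / (2 * pi)\<rfloor> \<and> a - 2 * pi * of_int \<lfloor>a / (2 * pi)\<rfloor> \<le> 2 * pi" for a :: real
  proof -
    have "of_int \<lfloor>a / (2 * pi)\<rfloor> * (2 * pi) \<le> a" "a \<le> (of_int \<lfloor>a / (2 * pi)\<rfloor> + 1) * (2 * pi)"
      using floor_divide_lower[of "2 * pi" a] floor_divide_upper[of "2 * pi" a] by auto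
    then show ?thesis by (simp add: algebra_simps)
  qed
  have "cmod (g (x - w) - g x) \<le> 0 + e" if e: "e > 0" for e
  proof -
    obtain p where p: "trigpoly p" "\<And>x. cmod (g x - p x) \<le> e / 2"
      using assms half_gt_zero[OF e] unfolding trig_approximable_def by meson
    have "g (x - w) - g x = (g (x - w) - p (x - w)) - (g x - p x)"
      using trigpoly_periodic[OF p(1), of x] by (simp add: w_def)
    also have "cmod \<dots> \<le> e / 2 + e / 2"
      by (rule order_trans[OF norm_triangle_ineq4]) (intro add_mono p)
    finally show ?thesis by simp
  qed
  then have "cmod (g (x - w) - g x) \<le> 0" by (rule field_le_epsilon)
  moreover have "x - w \<in> cbox (0, 0) (2 * pi, 2 * pi)"
    using *[of "fst x"] *[of "snd x"] by (cases x) (auto simp: w_def cbox_Pair_eq)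
  ultimately show ?thesis by (intro bexI[of _ "x - w"]) auto
qed

text \<open>\<open>r\<close> is orthogonal to every trigonometric polynomial \<open>p\<close>, so
  its squared norm equals its inner product with \<open>r - p\<close>, which is arbitrarily small. A
  continuous nonnegative function with zero integral vanishes on the square.\<close>

lemma fourier_uniqueness:
  assumes "trig_approximable r" "\<And>n. fourier_coeff r n = 0"
  shows "r x = 0"
proof -
  obtain B where bd: "\<And>x. cmod (r x) \<le> B" using trig_approximable_bounded[OF assms(1)] by blast
  have cont: "continuous_on UNIV r" using assms by (simp add: trig_approximable_continuous)
  have ortho: "torus_mean (\<lambda>x. r x * cnj (p x)) = 0" if "trigpoly p" for p
    using that
  proof (induction rule: trigpoly.induct)
    case (trigpoly_cis c n)
    have "torus_mean (\<lambda>x. cnj c * (r x * cis (- ip n x))) = 0"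
      using assms(2)[of n] by (simp add: torus_mean_cmult fourier_coeff_eq_torus_mean)
    then show ?case by (simp add: cis_cnj mult_ac)
  next
    case (trigpoly_add p q)
    then show ?case using cont trigpoly_continuous
      by (simp add: distrib_left torus_mean_add continuous_intros)
  qed
  have B: "0 \<le> B" using bd[of 0] norm_ge_zero order_trans by blast
  have "cmod (torus_mean (\<lambda>x. r x * cnj (r x))) \<le> 0 + e" if e: "e > 0" for e
  proof -
    \<comment> \<open>The \<open>+ 1\<close> guards against \<open>B = 0\<close>.\<close>
    have "e / (B + 1) > 0" using e B by simp
    then obtain p where p: "trigpoly p" "\<And>x. cmod (r x - p x) \<le> e / (B + 1)"
      using assms(1) unfolding trig_approximable_def by meson
    have "torus_mean (\<lambda>x. r x * cnj (r x)) = torus_mean (\<lambda>x. r x * cnj (p x) + r x * cnj (r x - p x))"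
      by (simp add: algebra_simps)
    also have "\<dots> = torus_mean (\<lambda>x. r x * cnj (r x - p x))"
      using cont trigpoly_continuous[OF p(1)] by (subst torus_mean_add) (auto simp: ortho[OF p(1)] intro!: continuous_intros)
    also have "cmod \<dots> \<le> B * (e / (B + 1))"
    proof (rule norm_torus_mean_le)
      show "continuous_on UNIV (\<lambda>x. r x * cnj (r x - p x))"
        using cont trigpoly_continuous[OF p(1)] by (intro continuous_intros)
      show "cmod (r x * cnj (r x - p x)) \<le> B * (e / (B + 1))" for x
        unfolding norm_mult complex_mod_cnj by (intro mult_mono bd p(2) B) auto
    qed
    also have "\<dots> \<le> e" using e B by (simp add: field_simps)
    finally show ?thesis by simp
  qed
  then have "cmod (torus_mean (\<lambda>x. r x * cnj (r x))) \<le> 0" by (rule field_le_epsilon)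
  then have "integral (cbox (0, 0) (2 * pi, 2 * pi)) (\<lambda>x. (cmod (r x))\<^sup>2) = 0"
    unfolding torus_mean_norm_sq[OF cont] by simp
  moreover have "box (0, 0) (2 * pi, 2 * pi) \<noteq> ({} :: (real \<times> real) set)"
    by (auto simp: box_ne_empty Basis_prod_def)
  moreover have "continuous_on (cbox (0, 0) (2 * pi, 2 * pi)) (\<lambda>x. (cmod (r x))\<^sup>2)"
    by (intro continuous_intros continuous_on_subset[OF cont]) simp
  ultimately have "\<forall>x\<in>cbox (0, 0) (2 * pi, 2 * pi). (cmod (r x))\<^sup>2 = 0"
    by (subst (asm) integral_cbox_eq_0_iff) simp_all
  moreover obtain y where "y \<in> cbox (0, 0) (2 * pi, 2 * pi)" "r y = r x"
    using trig_approximable_periodic[OF assms(1)] by blast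
  ultimately show ?thesis by fastforce
qed

section \<open>The sphere in DFS coordinates\<close>

text \<open>In the index type \<open>3\<close> the numerals 0 and 3 coincide, so the first coordinate of the paper has
  index 3.\<close>

definition xyz :: "real \<Rightarrow> real \<Rightarrow> real \<Rightarrow> real^3" where
  "xyz a b c = (\<chi> j. if j = 0 then a else if j = 1 then b else c)"

lemma xyz_nth: "xyz a b c $ 1 = b" "xyz a b c $ 2 = c" "xyz a b c $ 3 = a"
proof -
  have "(3::3) = 0" by simp
  then show "xyz a b c $ 3 = a" unfolding xyz_def by simp
qed (simp_all add: xyz_def)

lemma xyz_eqI:
  fixes v :: "real^3"
  shows "v $ 3 = a \<Longrightarrow> v $ 1 = b \<Longrightarrow> v $ 2 = c \<Longrightarrow> v = xyz a b c"
  by (simp add: vec_eq_iff forall_3 xyz_nth)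

lemma norm_xyz: "norm (xyz a b c) = sqrt (a\<^sup>2 + b\<^sup>2 + c\<^sup>2)"
  by (simp add: norm_eq_sqrt_inner inner_vec_def sum_3 xyz_nth power2_eq_square algebra_simps)

lemma dfs_phi_xyz: "dfs_phi x = xyz (cos (fst x) * sin (snd x)) (sin (fst x) * sin (snd x)) (cos (snd x))"
  by (simp add: dfs_phi_def xyz_def)

lemma sphere_identity: "(cos a * sin b)\<^sup>2 + (sin a * sin b)\<^sup>2 + (cos b)\<^sup>2 = (1::real)"
proof -
  have "(cos a * sin b)\<^sup>2 + (sin a * sin b)\<^sup>2 + (cos b)\<^sup>2 = ((cos a)\<^sup>2 + (sin a)\<^sup>2) * (sin b)\<^sup>2 + (cos b)\<^sup>2"
    by (simp only: power_mult_distrib distrib_right)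
  then show ?thesis by simp
qed

lemma dfs_phi_in_S2: "dfs_phi x \<in> S2"
  by (simp add: S2_def dfs_phi_xyz norm_xyz sphere_identity)

lemma continuous_on_dfs_phi: "continuous_on S dfs_phi"
  unfolding dfs_phi_def
proof (intro continuous_on_vec_lambda)
  show "continuous_on S (\<lambda>x. if j = 0 then cos (fst x) * sin (snd x)
      else if j = 1 then sin (fst x) * sin (snd x) else cos (snd x))" for j :: 3
    by (cases "j = 0"; cases "j = 1") (auto intro!: continuous_intros)
qed

text \<open>\<open>inv_into\<close> is a right inverse on the image, so a preimage in
  \<open>dfs_dom\<close> has to be exhibited: colatitude \<open>arccos c\<close>, and as longitude
  the polar angle of the first two coordinates.\<close>

lemma dfs_phi_inv: 
  assumes "\<xi> \<in> S2" shows "dfs_phi (dfs_phi_inv \<xi>) = \<xi>"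
proof -
  define a b c where abc: "a = \<xi> $ 3" "b = \<xi> $ 1" "c = \<xi> $ 2"
  have \<xi>: "\<xi> = xyz a b c" by (rule xyz_eqI) (simp_all add: abc)
  have sq: "a\<^sup>2 + b\<^sup>2 + c\<^sup>2 = 1" using assms by (simp add: S2_def \<xi> norm_xyz)
  have "c\<^sup>2 \<le> 1" using sq zero_le_power2[of a] zero_le_power2[of b] by linarith
  then have c: "\<bar>c\<bar> \<le> 1" by (simp add: abs_square_le_1)
  define \<theta> where "\<theta> = arccos c"
  have \<theta>: "0 \<le> \<theta>" "\<theta> \<le> pi" "cos \<theta> = c" using c by (auto simp: \<theta>_def arccos_lbound arccos_ubound)
  have s2: "(sin \<theta>)\<^sup>2 = a\<^sup>2 + b\<^sup>2" using sin_squared_eq[of \<theta>] sq \<theta>(3) by simp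
  have "\<exists>x\<in>dfs_dom. dfs_phi x = \<xi>"
  proof (cases "sin \<theta> = 0")
    case True
    then have ab: "a = 0" "b = 0" using s2 by (auto simp: sum_power2_eq_zero_iff)
    have "\<theta> = 0 \<or> \<theta> = pi"
      using True \<theta> sin_gt_zero[of \<theta>] by (metis less_eq_real_def less_irrefl)
    \<comment> \<open>At the poles \<open>dfs_dom\<close> contains longitude 0 only.\<close>
    then have "(0, \<theta>) \<in> dfs_dom" by (auto simp: dfs_dom_def)
    moreover have "dfs_phi (0, \<theta>) = \<xi>" using True \<theta>(3) by (simp add: dfs_phi_xyz \<xi> ab)
    ultimately show ?thesis by blast
  next
    case False
    have th: "0 < \<theta>" "\<theta> < pi" using False \<theta> by (auto simp: less_le)
    have "(a / sin \<theta>)\<^sup>2 + (b / sin \<theta>)\<^sup>2 = 1"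
      using False unfolding power_divide add_divide_distrib[symmetric] s2[symmetric] by simp
    then obtain t where t: "0 \<le> t" "t < 2 * pi" "a / sin \<theta> = cos t" "b / sin \<theta> = sin t"
      by (rule sincos_total_2pi)
    \<comment> \<open>\<open>sincos_total_2pi\<close> gives an angle from 0 to below
      \<open>2 * pi\<close>, while \<open>dfs_dom\<close> starts at \<open>- pi\<close>.\<close>
    define l where "l = (if t < pi then t else t - 2 * pi)"
    have l: "- pi \<le> l" "l < pi" "cos l = cos t" "sin l = sin t"
      using t by (auto simp: l_def cos_diff sin_diff)
    have "(l, \<theta>) \<in> dfs_dom" using l th by (auto simp: dfs_dom_def)
    moreover have "dfs_phi (l, \<theta>) = \<xi>"
      using False by (simp add: dfs_phi_xyz \<xi> \<theta>(3) l t(3,4)[symmetric])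
    ultimately show ?thesis by blast
  qed
  then have "\<xi> \<in> dfs_phi ` dfs_dom" by blast
  then show ?thesis unfolding dfs_phi_inv_def by (rule f_inv_into_f)
qed

lemma dfs_phi_reflect: "dfs_phi (a + pi, - b) = dfs_phi (a, b)"
  by (simp add: dfs_phi_xyz)

text \<open>Parallels are circles about the axis point at height \<open>cos b\<close>; meridians are
  great circles about the origin. \<open>?v\<close> is the velocity at \<open>s = 0\<close>. On the
  parallel of a pole \<open>?u\<close> and \<open>?v\<close> both vanish, which the norm bounds
  allow.\<close>

lemma dfs_phi_coordinate_curve:
  assumes "e = (1, 0) \<or> e = (0, 1)"
  shows "\<exists>p u v. norm u \<le> 1 \<and> norm v \<le> 1 \<and> (\<forall>s. dfs_phi (x + s *\<^sub>R e) = circle_curve p u v s)"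
  using assms
proof
  define a b where ab: "a = fst x" "b = snd x"
  have sb: "(sin b)\<^sup>2 \<le> 1" by (simp add: abs_square_le_1)
  assume e: "e = (1, 0)"
  let ?p = "xyz 0 0 (cos b)" and ?u = "xyz (cos a * sin b) (sin a * sin b) 0"
    and ?v = "xyz (- sin a * sin b) (cos a * sin b) 0"
  have "(cos a * sin b)\<^sup>2 + (sin a * sin b)\<^sup>2 = (sin b)\<^sup>2"
    using sphere_identity[of a b] sin_squared_eq[of b] by linarith
  then have "norm ?u \<le> 1" "norm ?v \<le> 1"
    using sb by (auto simp: norm_xyz add.commute)
  moreover have "dfs_phi (x + s *\<^sub>R e) = circle_curve ?p ?u ?v s" for s
    unfolding dfs_phi_xyz circle_curve_def e ab
    by (rule xyz_eqI[symmetric]) (simp_all add: xyz_nth cos_add sin_add algebra_simps)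
  ultimately show ?thesis by blast
next
  define a b where ab: "a = fst x" "b = snd x"
  assume e: "e = (0, 1)"
  let ?u = "xyz (cos a * sin b) (sin a * sin b) (cos b)"
    and ?v = "xyz (cos a * cos b) (sin a * cos b) (- sin b)"
  have "norm ?u \<le> 1" "norm ?v \<le> 1"
    \<comment> \<open>A quarter turn in \<open>b\<close> takes \<open>?u\<close> to
      \<open>?v\<close>.\<close>
    using sphere_identity[of a b] sphere_identity[of a "pi/2 + b"]
    by (simp_all add: norm_xyz sin_add cos_add)
  moreover have "dfs_phi (x + s *\<^sub>R e) = circle_curve 0 ?u ?v s" for s
    unfolding dfs_phi_xyz circle_curve_def e ab
    by (rule xyz_eqI[symmetric]) (simp_all add: xyz_nth cos_add sin_add algebra_simps)
  ultimately show ?thesis by blast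
qed

lemma trigpoly_trig:
  "trigpoly (\<lambda>x. complex_of_real (cos (fst x)))" "trigpoly (\<lambda>x. complex_of_real (sin (fst x)))"
  "trigpoly (\<lambda>x. complex_of_real (cos (snd x)))" "trigpoly (\<lambda>x. complex_of_real (sin (snd x)))"
proof -
  have c: "complex_of_real (cos t) = (1/2) * cis t + (1/2) * cis (- t)" for t
    by (simp add: complex_eq_iff)
  have s: "complex_of_real (sin t) = (- \<i>/2) * cis t + (\<i>/2) * cis (- t)" for t
    by (simp add: complex_eq_iff)
  have x: "fst x = ip (1, 0) x" "- ip (1, 0) x = ip (-1, 0) x" "snd x = ip (0, 1) x" "- ip (0, 1) x = ip (0, -1) x" for x
    by (simp_all add: ip_def)
  show "trigpoly (\<lambda>x. complex_of_real (cos (fst x)))" "trigpoly (\<lambda>x. complex_of_real (sin (fst x)))"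
    "trigpoly (\<lambda>x. complex_of_real (cos (snd x)))" "trigpoly (\<lambda>x. complex_of_real (sin (snd x)))"
    unfolding c s x by (intro trigpoly_add trigpoly_cis)+
qed

text \<open>Each coordinate of \<open>dfs_phi\<close> is a product of sines and cosines, and
  \<open>trigpoly\<close> is closed under sums and products.\<close>

lemma trigpoly_real_polynomial_function:
  assumes "real_polynomial_function q"
  shows "trigpoly (\<lambda>x. complex_of_real (q (dfs_phi x)))"
  using assms
proof (induction rule: real_polynomial_function.induct)
  case (linear f)
  interpret f: bounded_linear f by fact
  have "xyz a b c = a *\<^sub>R xyz 1 0 0 + b *\<^sub>R xyz 0 1 0 + c *\<^sub>R xyz 0 0 1" for a b c
    by (rule xyz_eqI[symmetric]) (simp_all add: xyz_nth)
  then have lin: "f (xyz a b c) = f (a *\<^sub>R xyz 1 0 0 + b *\<^sub>R xyz 0 1 0 + c *\<^sub>R xyz 0 0 1)" for a b c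
    by (rule arg_cong)
  define d where "d = (f (xyz 1 0 0), f (xyz 0 1 0), f (xyz 0 0 1))"
  have "f (xyz a b c) = a * fst d + b * fst (snd d) + c * snd (snd d)" for a b c
    by (subst lin) (simp only: f.add f.scaleR d_def fst_conv snd_conv real_scaleR_def)
  then show ?case
    by (simp only: dfs_phi_xyz of_real_add of_real_mult) (intro trigpoly_add trigpoly_mult trigpoly_trig trigpoly_const)
next
  case (const c)
  then show ?case by (rule trigpoly_const)
qed (simp_all add: trigpoly_add trigpoly_mult)

text \<open>Approximating on the sphere, before pulling back, makes the approximants on the plane
  periodic automatically.\<close>

lemma trig_approximable_dfs:
  assumes "continuous_on S2 f"
  shows "trig_approximable (\<lambda>x. f (dfs_phi x))"
  unfolding trig_approximable_def
proof (intro conjI allI impI)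
  show "continuous_on UNIV (\<lambda>x. f (dfs_phi x))"
    by (rule continuous_on_compose2[OF assms continuous_on_dfs_phi]) (auto simp: dfs_phi_in_S2)
  fix e :: real assume e: "e > 0"
  have "compact S2" by (simp add: S2_def)
  from Stone_Weierstrass_polynomial_function[OF this assms e] obtain q where q: "polynomial_function q" "\<And>\<xi>. \<xi> \<in> S2 \<Longrightarrow> cmod (f \<xi> - q \<xi>) < e"
    by blast
  have "real_polynomial_function (Re \<circ> q)" "real_polynomial_function (Im \<circ> q)"
    using q(1) bounded_linear_Re bounded_linear_Im unfolding polynomial_function_def by auto
  from this[THEN trigpoly_real_polynomial_function]
  have "trigpoly (\<lambda>x. complex_of_real (Re (q (dfs_phi x))) + \<i> * complex_of_real (Im (q (dfs_phi x))))"
    unfolding o_def by (intro trigpoly_add trigpoly_mult trigpoly_const)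
  then have "trigpoly (\<lambda>x. q (dfs_phi x))" by (simp add: complex_eq[symmetric])
  then show "\<exists>p. trigpoly p \<and> (\<forall>x. cmod (f (dfs_phi x) - p x) \<le> e)"
    using q(2)[OF dfs_phi_in_S2] by (intro exI[of _ "\<lambda>x. q (dfs_phi x)"]) (simp add: less_imp_le)
qed

section \<open>Coefficient tails and partial sums\<close>

text \<open>A frequency between \<open>2 ^ j\<close> and \<open>2 ^ Suc j\<close> with step
  \<open>2 ^ -j\<close> has its phase in this range, where
  \<open>cos s \<le> cos (pi/4) \<le> 7/8\<close>. The value 7/8 makes 2 - 2 * 7/8 equal to the
  square of 1/2.\<close>

lemma norm_cis_minus_one_ge:
  assumes "1 \<le> \<bar>s\<bar>" "\<bar>s\<bar> \<le> 2"
  shows "1/2 \<le> cmod (cis s - 1)"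
proof -
  have "cos \<bar>s\<bar> \<le> cos (pi/4)"
    using assms pi_less_4 pi_ge_two by (intro cos_monotone_0_pi_le) auto
  moreover have "sqrt 2 \<le> 7/4" by (rule real_le_lsqrt) (auto simp: power2_eq_square)
  ultimately have c: "cos s \<le> 7/8" by (simp add: cos_45)
  have "(cmod (cis s - 1))\<^sup>2 = 2 - 2 * cos s"
    unfolding cmod_power2 using sin_cos_squared_add[of s] by (simp add: power2_eq_square algebra_simps)
  then have "(1/2)\<^sup>2 \<le> (cmod (cis s - 1))\<^sup>2" using c by (simp add: power2_eq_square)
  then show ?thesis by (rule power2_le_imp_le) simp
qed

text \<open>For frequencies \<open>n\<close> with \<open>2 ^ j \<le> \<bar>n\<^sub>i\<bar> < 2 ^ (j + 1)\<close>, differencing with step \<open>2 ^ -j\<close> in the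
  \<open>i\<close>-th variable multiplies every coefficient by a factor bounded away from 0, so Bessel's
  inequality for the difference controls the coefficients themselves.\<close>

lemma shell_sum_bound:
  assumes g: "trig_approximable g" and E: "finite E" and "A \<ge> 0"
    and diff: "\<And>t x. t > 0 \<Longrightarrow> cmod ((fdiff (t *\<^sub>R e) ^^ Suc k) g x) \<le> A * t powr r"
    and E_lo: "\<And>n. n \<in> E \<Longrightarrow> 2 ^ j \<le> \<bar>ip n e\<bar>"
    and E_hi: "\<And>n. n \<in> E \<Longrightarrow> \<bar>ip n e\<bar> \<le> 2 ^ Suc j"
    and E_box: "\<And>n. n \<in> E \<Longrightarrow> \<bar>fst n\<bar> < 2 ^ Suc j \<and> \<bar>snd n\<bar> < 2 ^ Suc j"
  shows "(\<Sum>n\<in>E. cmod (fourier_coeff g n)) \<le> 8 * 2 ^ k * A * (2 powr (1 - r)) ^ j"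
proof -
  define t :: real where "t = (1/2) ^ j"
  define c where "c = fourier_coeff g"
  define D where "D = A * t powr r"
  have t: "t > 0" by (simp add: t_def)
  have factor: "cmod (c n) \<le> 2 ^ Suc k * cmod (fourier_coeff ((fdiff (t *\<^sub>R e) ^^ Suc k) g) n)" if n: "n \<in> E" for n
  proof -
    have "ip n (t *\<^sub>R e) = ip n e / 2 ^ j" by (simp add: ip_def t_def power_one_over add_divide_distrib)
    then have "\<bar>ip n (t *\<^sub>R e)\<bar> = \<bar>ip n e\<bar> / 2 ^ j" by simp
    moreover have "1 \<le> \<bar>ip n e\<bar> / 2 ^ j" "\<bar>ip n e\<bar> / 2 ^ j \<le> 2"
      using E_lo[OF n] E_hi[OF n] by (simp_all add: pos_le_divide_eq pos_divide_le_eq)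
    ultimately have "1/2 \<le> cmod (cis (ip n (t *\<^sub>R e)) - 1)"
      by (intro norm_cis_minus_one_ge) simp_all
    then have "(1/2) ^ Suc k \<le> cmod (cis (ip n (t *\<^sub>R e)) - 1) ^ Suc k"
      by (rule power_mono) simp
    then have "(1/2) ^ Suc k * cmod (c n) \<le> cmod (fourier_coeff ((fdiff (t *\<^sub>R e) ^^ Suc k) g) n)"
      unfolding fourier_coeff_fdiff[OF g] norm_mult norm_power c_def by (rule mult_right_mono) simp
    then show ?thesis by (simp add: power_one_over field_simps)
  qed
  have "(\<Sum>n\<in>E. (cmod (fourier_coeff ((fdiff (t *\<^sub>R e) ^^ Suc k) g) n))\<^sup>2) \<le> D\<^sup>2"
    using diff[OF t] unfolding D_def
    by (intro Bessel_inequality E trig_approximable_continuous trig_approximable_fdiff g)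
  then have "(2 ^ Suc k)\<^sup>2 * (\<Sum>n\<in>E. (cmod (fourier_coeff ((fdiff (t *\<^sub>R e) ^^ Suc k) g) n))\<^sup>2) \<le> (2 ^ Suc k)\<^sup>2 * D\<^sup>2"
    by (intro mult_left_mono) auto
  moreover have "(\<Sum>n\<in>E. (cmod (c n))\<^sup>2) \<le> (2 ^ Suc k)\<^sup>2 * (\<Sum>n\<in>E. (cmod (fourier_coeff ((fdiff (t *\<^sub>R e) ^^ Suc k) g) n))\<^sup>2)"
    unfolding sum_distrib_left power_mult_distrib[symmetric]
    by (intro sum_mono power_mono factor) auto
  ultimately have sq: "(\<Sum>n\<in>E. (cmod (c n))\<^sup>2) \<le> (2 ^ Suc k * D)\<^sup>2"
    unfolding power_mult_distrib[of "2 ^ Suc k" D] by linarith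
  \<comment> \<open>Each coordinate takes fewer than \<open>4 * 2 ^ j\<close> integer
    values.\<close>
  have "card E \<le> card ({- (2 ^ Suc j) <..< (2::int) ^ Suc j} \<times> {- (2 ^ Suc j) <..< (2::int) ^ Suc j})"
    using E_box by (intro card_mono) (fastforce simp: abs_less_iff)+
  also have "\<dots> \<le> (4 * 2 ^ j) * (4 * 2 ^ j)"
    unfolding card_cartesian_product
    by (intro mult_mono) (auto simp: nat_le_iff)
  finally have card: "real (card E) \<le> (4 * 2 ^ j)\<^sup>2"
    by (simp add: power2_eq_square flip: of_nat_le_iff[where 'a=real])
  \<comment> \<open>The root of the number of frequencies costs \<open>4 * 2 ^ j\<close>; this is
    the origin of the 1 in the exponent \<open>1 - r\<close>.\<close>
  have "(\<Sum>n\<in>E. 1 * cmod (c n))\<^sup>2 \<le> (\<Sum>n\<in>E. 1\<^sup>2) * (\<Sum>n\<in>E. (cmod (c n))\<^sup>2)"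
    by (rule Cauchy_Schwarz_ineq_sum)
  also have "\<dots> \<le> (4 * 2 ^ j)\<^sup>2 * (2 ^ Suc k * D)\<^sup>2"
    using card sq by (intro mult_mono) (auto intro: sum_nonneg)
  also have "\<dots> = (4 * 2 ^ j * (2 ^ Suc k * D))\<^sup>2" by (simp only: power_mult_distrib)
  finally have "(\<Sum>n\<in>E. cmod (c n))\<^sup>2 \<le> (4 * 2 ^ j * (2 ^ Suc k * D))\<^sup>2" by simp
  then have "(\<Sum>n\<in>E. cmod (c n)) \<le> 4 * 2 ^ j * (2 ^ Suc k * D)"
    by (rule power2_le_imp_le) (use assms in \<open>simp add: D_def\<close>)
  also have "\<dots> = 8 * 2 ^ k * A * (2 ^ j * t powr r)" by (simp add: D_def)
  also have "2 ^ j * t powr r = (2 powr (1 - r)) ^ j"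
  proof -
    have "t = 2 powr (- real j)" by (simp add: t_def powr_minus powr_realpow power_one_over inverse_eq_divide)
    then have "2 ^ j * t powr r = 2 powr real j * 2 powr (- real j * r)"
      by (simp add: powr_powr powr_realpow)
    also have "\<dots> = 2 powr ((1 - r) * real j)" by (simp add: powr_add[symmetric] algebra_simps)
    also have "\<dots> = (2 powr (1 - r)) ^ j" by (simp add: powr_powr[symmetric] powr_realpow)
    finally show ?thesis .
  qed
  finally show ?thesis by (simp add: c_def)
qed

text \<open>The sum is dominated by the geometric series starting at the least index
  \<open>m\<close> of \<open>J\<close>, and \<open>2 ^ m > h / 4\<close> turns \<open>q ^ m\<close>
  into a power of \<open>h\<close>.\<close>

lemma geometric_tail_bound:
  assumes q: "q = 2 powr - \<delta>" "\<delta> > 0" and J: "finite J" and h: "h \<ge> (1::nat)"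
    and lower: "\<And>j. j \<in> J \<Longrightarrow> real h < 4 * 2 ^ j"
  shows "(\<Sum>j\<in>J. q ^ j) \<le> 4 powr \<delta> / (1 - q) * real h powr - \<delta>"
proof -
  have q01: "0 < q" "q < 1" using q by (auto simp: powr_less_one)
  show ?thesis
  proof (cases "J = {}")
    case True
    then show ?thesis using q01 by simp
  next
    case False
    define m where "m = Min J"
    have m: "m \<in> J" "\<And>j. j \<in> J \<Longrightarrow> m \<le> j" using J False by (auto simp: m_def)
    have "(\<Sum>j\<in>J. q ^ j) = (\<Sum>j\<in>J. q ^ m * q ^ (j - m))"
      using m by (intro sum.cong) (auto simp: power_add[symmetric])
    also have "\<dots> = q ^ m * (\<Sum>i\<in>(\<lambda>j. j - m) ` J. q ^ i)"
      using m by (subst sum.reindex) (auto simp: inj_on_def sum_distrib_left eq_diff_iff)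
    also have "\<dots> \<le> q ^ m * (1 / (1 - q))"
    proof (rule mult_left_mono)
      have "(\<Sum>i\<in>(\<lambda>j. j - m) ` J. q ^ i) \<le> (\<Sum>i. q ^ i)"
        using q01 J by (intro sum_le_suminf) auto
      then show "(\<Sum>i\<in>(\<lambda>j. j - m) ` J. q ^ i) \<le> 1 / (1 - q)"
        using q01 by (simp add: suminf_geometric)
    qed (use q01 in simp)
    also have "q ^ m = (2 ^ m) powr - \<delta>"
      by (simp add: q(1) powr_powr powr_realpow[symmetric] mult.commute)
    also have "\<dots> \<le> (real h / 4) powr - \<delta>"
      using lower[OF m(1)] h q(2) by (intro powr_mono2') auto
    also have "(real h / 4) powr - \<delta> = 4 powr \<delta> * real h powr - \<delta>"
      using h by (simp add: powr_divide powr_minus_divide)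
    finally show ?thesis using q01 by (simp add: divide_right_mono)
  qed
qed

section \<open>Summability outside discs and convergence of disc sums\<close>

definition disc :: "nat \<Rightarrow> (int \<times> int) set" where
  "disc h = {n. sqrt (real_of_int (fst n)^2 + real_of_int (snd n)^2) \<le> real h}"

lemma finite_disc: "finite (disc h)"
proof (rule finite_subset)
  show "disc h \<subseteq> {- int h..int h} \<times> {- int h..int h}"
  proof
    fix n assume n: "n \<in> disc h"
    have "\<bar>real_of_int (fst n)\<bar> \<le> real h" "\<bar>real_of_int (snd n)\<bar> \<le> real h"
      using n real_sqrt_ge_abs1[of "real_of_int (fst n)" "real_of_int (snd n)"]
        real_sqrt_ge_abs2[of "real_of_int (snd n)" "real_of_int (fst n)"]
      unfolding disc_def by (simp_all only: mem_Collect_eq)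
    then show "n \<in> {- int h..int h} \<times> {- int h..int h}"
      by (cases n) (simp, linarith)
  qed
qed simp

text \<open>The shells are dyadic in the maximum norm, so that in each of them some coordinate is at
  least \<open>2 ^ j\<close> and a difference in that direction applies. Two directions with a
  constant 8 each give the 16.\<close>

lemma tail_sum_bound:
  assumes g: "trig_approximable g" and "A \<ge> 0" "r > 1" "h \<ge> 1" and F: "finite F" "F \<inter> disc h = {}"
    and diff: "\<And>e t x. e = (1, 0) \<or> e = (0, 1) \<Longrightarrow> t > 0 \<Longrightarrow>
        cmod ((fdiff (t *\<^sub>R e) ^^ Suc k) g x) \<le> A * t powr r"
  shows "(\<Sum>n\<in>F. cmod (fourier_coeff g n))
      \<le> 16 * 2 ^ k * (4 powr (r - 1) / (1 - 2 powr (1 - r))) * A * real h powr (1 - r)"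
proof -
  define q where "q = (2::real) powr (1 - r)"
  define c where "c = (\<lambda>n. cmod (fourier_coeff g n))"
  define mx where "mx = (\<lambda>n::int \<times> int. nat (max \<bar>fst n\<bar> \<bar>snd n\<bar>))"
  \<comment> \<open>The Euclidean norm is at most twice the maximum norm; hence
    \<open>h < 4 * 2 ^ j\<close> for each shell that meets \<open>F\<close>.\<close>
  have mx: "real h < 2 * real (mx n)" "1 \<le> mx n" if "n \<in> F" for n
  proof -
    have "real h < sqrt (real_of_int (fst n)^2 + real_of_int (snd n)^2)"
      using that F by (auto simp: disc_def)
    also have "\<dots> \<le> \<bar>real_of_int (fst n)\<bar> + \<bar>real_of_int (snd n)\<bar>" by (rule sqrt_sum_squares_le_sum_abs)
    also have "\<dots> \<le> 2 * real (mx n)" by (simp add: mx_def)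
    finally show "real h < 2 * real (mx n)" .
    then show "1 \<le> mx n" using assms by linarith
  qed
  have "\<forall>n\<in>F. \<exists>j. 2 ^ j \<le> mx n \<and> mx n < 2 ^ (j + 1)"
    using mx(2) ex_power_ivl1[of 2] by simp
  then obtain J where J: "\<And>n. n \<in> F \<Longrightarrow> 2 ^ J n \<le> mx n" "\<And>n. n \<in> F \<Longrightarrow> mx n < 2 ^ Suc (J n)"
    by (metis Suc_eq_plus1)
  have shell: "(\<Sum>n\<in>{n\<in>F. J n = j}. c n) \<le> 16 * 2 ^ k * A * q ^ j" for j
  proof -
    define Fj where "Fj = {n\<in>F. J n = j}"
    \<comment> \<open>If the first coordinate is below \<open>2 ^ j\<close>, the second one must
      reach it, so \<open>F1\<close> and \<open>F2\<close> are handled by differences in different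
      variables.\<close>
    define F1 where "F1 = {n\<in>Fj. 2 ^ j \<le> \<bar>fst n\<bar>}"
    define F2 where "F2 = {n\<in>Fj. \<not> 2 ^ j \<le> \<bar>fst n\<bar>}"
    have hi: "\<bar>fst n\<bar> < 2 ^ Suc j \<and> \<bar>snd n\<bar> < 2 ^ Suc j" if "n \<in> Fj" for n
    proof -
      have "mx n < 2 ^ Suc j" using J(2)[of n] that by (auto simp: Fj_def)
      then have "int (mx n) < 2 ^ Suc j" by (metis of_nat_less_iff of_nat_numeral of_nat_power)
      then show ?thesis by (simp add: mx_def split: if_splits)
    qed
    have lo: "2 ^ j \<le> \<bar>fst n\<bar> \<or> 2 ^ j \<le> \<bar>snd n\<bar>" if "n \<in> Fj" for n
    proof -
      have "2 ^ j \<le> mx n" using J(1)[of n] that by (auto simp: Fj_def)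
      then have "2 ^ j \<le> int (mx n)" by (metis of_nat_le_iff of_nat_numeral of_nat_power)
      then show ?thesis by (simp add: mx_def max_def split: if_splits)
    qed
    have re: "2 ^ m \<le> \<bar>real_of_int i\<bar> \<longleftrightarrow> 2 ^ m \<le> \<bar>i\<bar>" "\<bar>real_of_int i\<bar> \<le> 2 ^ m \<longleftrightarrow> \<bar>i\<bar> \<le> 2 ^ m" for m and i :: int
      by (metis of_int_abs of_int_le_iff of_int_numeral of_int_power)+
    have "finite Fj" using F by (simp add: Fj_def)
    then have fin: "finite F1" "finite F2" by (auto simp: F1_def F2_def)
    have "(\<Sum>n\<in>F1. c n) \<le> 8 * 2 ^ k * A * q ^ j" unfolding c_def q_def
    proof (rule shell_sum_bound[OF g fin(1) assms(2) diff])
      fix n assume n: "n \<in> F1"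
      show "2 ^ j \<le> \<bar>ip n (1, 0)\<bar>" using n by (simp add: ip_def F1_def re)
      show "\<bar>ip n (1, 0)\<bar> \<le> 2 ^ Suc j" using n hi[of n] unfolding ip_def F1_def
        using re(2)[of "fst n" "Suc j"] by simp
      show "\<bar>fst n\<bar> < 2 ^ Suc j \<and> \<bar>snd n\<bar> < 2 ^ Suc j" using n hi by (simp add: F1_def)
    qed auto
    moreover have "(\<Sum>n\<in>F2. c n) \<le> 8 * 2 ^ k * A * q ^ j" unfolding c_def q_def
    proof (rule shell_sum_bound[OF g fin(2) assms(2) diff])
      fix n assume n: "n \<in> F2"
      show "2 ^ j \<le> \<bar>ip n (0, 1)\<bar>" using n lo[of n] by (auto simp add: ip_def F2_def re)
      show "\<bar>ip n (0, 1)\<bar> \<le> 2 ^ Suc j" using n hi[of n] unfolding ip_def F2_def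
        using re(2)[of "snd n" "Suc j"] by simp
      show "\<bar>fst n\<bar> < 2 ^ Suc j \<and> \<bar>snd n\<bar> < 2 ^ Suc j" using n hi by (simp add: F2_def)
    qed auto
    moreover have "(\<Sum>n\<in>Fj. c n) = (\<Sum>n\<in>F1. c n) + (\<Sum>n\<in>F2. c n)"
    proof -
      have "Fj = F1 \<union> F2" "F1 \<inter> F2 = {}" by (auto simp: F1_def F2_def)
      then show ?thesis using fin by (simp add: sum.union_disjoint)
    qed
    ultimately show ?thesis unfolding Fj_def by linarith
  qed
  have "(\<Sum>n\<in>F. c n) = (\<Sum>j\<in>J ` F. \<Sum>n\<in>{n\<in>F. J n = j}. c n)"
    by (rule sum.image_gen[OF F(1)])
  also have "\<dots> \<le> (\<Sum>j\<in>J ` F. 16 * 2 ^ k * A * q ^ j)" by (intro sum_mono shell)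
  also have "\<dots> = 16 * 2 ^ k * A * (\<Sum>j\<in>J ` F. q ^ j)" by (simp add: sum_distrib_left)
  also have "\<dots> \<le> 16 * 2 ^ k * A * (4 powr (r - 1) / (1 - q) * real h powr - (r - 1))"
  proof (intro mult_left_mono geometric_tail_bound)
    fix j assume "j \<in> J ` F"
    then obtain n where n: "n \<in> F" "j = J n" by blast
    have "real (mx n) < 2 ^ Suc j" using J(2)[OF n(1)] n(2) by (metis of_nat_less_iff of_nat_numeral of_nat_power)
    then show "real h < 4 * 2 ^ j" using mx(1)[OF n(1)] by simp
  qed (use assms F in \<open>auto simp: q_def\<close>)
  finally show ?thesis by (simp add: c_def q_def mult_ac)
qed

text \<open>Tail bounds over finite sets make the disc sums uniformly Cauchy. Their limit
  \<open>G\<close> is again \<open>trig_approximable\<close> with the coefficients of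
  \<open>g\<close>, so uniqueness identifies it with \<open>g\<close>, and the bound
  \<open>R h\<close> survives the passage to the limit.\<close>

lemma fourier_partial_sum_error:
  assumes g: "trig_approximable g"
    and tail: "\<And>h F. h \<ge> 1 \<Longrightarrow> finite F \<Longrightarrow> F \<inter> disc h = {} \<Longrightarrow> (\<Sum>n\<in>F. cmod (fourier_coeff g n)) \<le> R h"
    and R: "R \<longlonglongrightarrow> 0" and "h \<ge> 1"
  shows "cmod (g x - (\<Sum>n\<in>disc h. fourier_coeff g n * cis (ip n x))) \<le> R h"
proof -
  define c where "c = fourier_coeff g"
  define S where "S = (\<lambda>h x. \<Sum>n\<in>disc h. c n * cis (ip n x))"
  have close: "cmod (S h' x - S h x) \<le> R h" if "1 \<le> h" "h \<le> h'" for h h' x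
  proof -
    have sub: "disc h \<subseteq> disc h'" using that by (auto simp: disc_def)
    have "S h' x - S h x = (\<Sum>n\<in>disc h' - disc h. c n * cis (ip n x))"
      unfolding S_def by (rule sum_diff[OF finite_disc sub, symmetric])
    also have "cmod \<dots> \<le> (\<Sum>n\<in>disc h' - disc h. cmod (c n))"
      by (rule order_trans[OF norm_sum]) (simp add: norm_mult)
    also have "\<dots> \<le> R h" unfolding c_def using that by (intro tail) (auto simp: finite_disc)
    finally show ?thesis .
  qed
  have small: "\<exists>N\<ge>1. \<forall>h\<ge>N. R h < e" if "e > 0" for e
  proof -
    have "eventually (\<lambda>h. R h < e) sequentially" using R that by (rule order_tendstoD)
    then obtain N where "\<forall>h\<ge>N. R h < e" by (auto simp: eventually_sequentially)
    then show ?thesis by (intro exI[of _ "max N 1"]) auto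
  qed
  have "Cauchy (\<lambda>h. S h x)" for x
  proof (rule metric_CauchyI)
    fix e :: real assume "e > 0"
    then obtain N where N: "N \<ge> 1" "\<forall>h\<ge>N. R h < e" using small by blast
    have "dist (S m x) (S n x) < e" if "m \<ge> N" "n \<ge> N" for m n
    proof (cases "m \<le> n")
      case True
      then show ?thesis using close[of m n x] N that by (auto simp: dist_norm norm_minus_commute intro: le_less_trans)
    next
      case False
      then show ?thesis using close[of n m x] N that by (auto simp: dist_norm intro: le_less_trans)
    qed
    then show "\<exists>M. \<forall>m\<ge>M. \<forall>n\<ge>M. dist (S m x) (S n x) < e" by blast
  qed
  then obtain G where G: "\<And>x. (\<lambda>h. S h x) \<longlonglongrightarrow> G x"
    unfolding Cauchy_convergent_iff convergent_def by metis
  have err: "cmod (G x - S h x) \<le> R h" if h: "1 \<le> h" for h x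
  proof (rule tendsto_upperbound)
    show "(\<lambda>h'. cmod (S h' x - S h x)) \<longlonglongrightarrow> cmod (G x - S h x)" by (intro tendsto_intros G)
    show "\<forall>\<^sub>F h' in sequentially. cmod (S h' x - S h x) \<le> R h"
      unfolding eventually_sequentially using close[OF h] by blast
  qed simp
  have tS: "trigpoly (S h)" for h unfolding S_def by (rule trigpoly_sum[OF finite_disc])
  have contG: "continuous_on UNIV G"
  proof (rule uniform_limit_theorem)
    show "uniform_limit UNIV S G sequentially"
    proof (rule uniform_limitI)
      fix e :: real assume "e > 0"
      then obtain N where N: "N \<ge> 1" "\<forall>h\<ge>N. R h < e" using small by blast
      then show "\<forall>\<^sub>F h in sequentially. \<forall>x\<in>UNIV. dist (S h x) (G x) < e"
        unfolding eventually_sequentially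
        by (intro exI[of _ N]) (metis dist_norm err le_less_trans norm_minus_commute order_trans)
    qed
    show "\<forall>\<^sub>F h in sequentially. continuous_on UNIV (S h)" using trigpoly_continuous[OF tS] by simp
  qed simp
  have appG: "trig_approximable G"
    unfolding trig_approximable_def
  proof (intro conjI contG allI impI)
    fix e :: real assume "e > 0"
    then obtain N where N: "N \<ge> 1" "\<forall>h\<ge>N. R h < e" using small by blast
    then have "cmod (G x - S N x) \<le> e" for x using err[of N x] by (meson less_imp_le order_trans order_refl)
    then show "\<exists>p. trigpoly p \<and> (\<forall>x. cmod (G x - p x) \<le> e)" using tS by blast
  qed
  have coeffG: "fourier_coeff G n = c n" for n
  proof -
    have "cmod (fourier_coeff G n - c n) \<le> 0 + e" if "e > 0" for e
    proof -
      obtain N where N: "N \<ge> 1" "\<forall>h\<ge>N. R h < e" using small \<open>e > 0\<close> by blast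
      obtain M where M: "sqrt (real_of_int (fst n)^2 + real_of_int (snd n)^2) \<le> real M"
        using real_arch_simple by blast
      \<comment> \<open>Large enough for the disc to contain \<open>n\<close> and for the error to
        fall below \<open>e\<close>.\<close>
      define h where "h = max N M"
      have h: "n \<in> disc h" "R h < e" "1 \<le> h" using M N by (auto simp: disc_def h_def)
      have "fourier_coeff (S h) n = c n" unfolding S_def using h by (simp add: fourier_coeff_sum finite_disc)
      then have "fourier_coeff G n - c n = fourier_coeff (\<lambda>x. G x - S h x) n"
        using contG trigpoly_continuous[OF tS] by (simp add: fourier_coeff_diff)
      also have "cmod \<dots> \<le> R h"
        using contG trigpoly_continuous[OF tS] err h by (intro norm_fourier_coeff_le continuous_on_diff) auto
      finally show ?thesis using h by simp
    qed
    then have "cmod (fourier_coeff G n - c n) \<le> 0" by (rule field_le_epsilon)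
    then show ?thesis by simp
  qed
  have "g x - G x = 0"
    using g appG coeffG by (intro fourier_uniqueness[of "\<lambda>x. g x - G x"] trig_approximable_diff)
      (auto simp: fourier_coeff_diff trig_approximable_continuous c_def)
  then show ?thesis using err[OF \<open>h \<ge> 1\<close>, of x] by (simp add: S_def c_def)
qed

text \<open>By the symmetry of the coefficients, \<open>c n\<close> times the second exponential of
  \<open>dfs_e n\<close> is exactly the term of frequency \<open>Mref n\<close>, so the reflected
  half of the disc is filled in.\<close>

lemma Kh_eq_disc_sum:
  assumes f: "trig_approximable (dfs_tilde f)"
  shows "Kh h f \<xi> = (\<Sum>n\<in>disc h. fourier_coeff (dfs_tilde f) n * cis (ip n (dfs_phi_inv \<xi>)))"
proof -
  define c where "c = fourier_coeff (dfs_tilde f)"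
  define x where "x = dfs_phi_inv \<xi>"
  define T where "T = (\<lambda>n. c n * cis (ip n x))"
  \<comment> \<open>Frequencies with \<open>snd n = 0\<close> are fixed by \<open>Mref\<close>;
    leaving them out of \<open>P\<close> counts them once.\<close>
  define P where "P = {n \<in> Omega h. snd n \<noteq> 0}"
  have M: "c (Mref n) = (-1) powi fst n * c n" for n unfolding c_def
    by (rule fourier_coeff_Mref[OF f]) (simp add: dfs_tilde_def dfs_phi_reflect)
  have split: "disc h = Omega h \<union> Mref ` P"
  proof (intro set_eqI iffI)
    fix n assume n: "n \<in> disc h"
    show "n \<in> Omega h \<union> Mref ` P"
    proof (cases "snd n \<ge> 0")
      case False
      then have "Mref n \<in> P" "n = Mref (Mref n)" using n by (auto simp: P_def Omega_def disc_def Mref_def)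
      then show ?thesis by blast
    qed (use n in \<open>auto simp: Omega_def disc_def\<close>)
  qed (auto simp: P_def Omega_def disc_def Mref_def)
  have disj: "Omega h \<inter> Mref ` P = {}" by (auto simp: P_def Omega_def Mref_def)
  have fin: "finite (Omega h)" "finite (Mref ` P)" "finite P"
    using finite_disc[of h] unfolding split by (auto simp: P_def)
  have inj: "inj_on Mref P" by (auto simp: inj_on_def Mref_def prod_eq_iff)
  have "Kh h f \<xi> = (\<Sum>n\<in>Omega h. T n + (if snd n \<noteq> 0 then T (Mref n) else 0))"
    unfolding Kh_def dfs_S_def
    by (intro sum.cong) (auto simp: dfs_b_def dfs_e_def T_def M x_def c_def[symmetric] cis_conv_exp algebra_simps)
  also have "\<dots> = (\<Sum>n\<in>Omega h. T n) + (\<Sum>n\<in>P. T (Mref n))"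
    unfolding P_def using fin by (simp add: sum.distrib sum.inter_filter)
  also have "\<dots> = (\<Sum>n\<in>disc h. T n)"
    unfolding split using fin disj inj by (simp add: sum.union_disjoint sum.reindex)
  finally show ?thesis by (simp add: T_def c_def x_def)
qed

text \<open>Reduces differences on the plane to differences of one variable, where the Hoelder bound
  applies.\<close>

lemma fdiff_along_line:
  fixes e x :: "'a::real_vector"
  shows "(fdiff (t *\<^sub>R e) ^^ m) G (x + s *\<^sub>R e) = (fdiff t ^^ m) (\<lambda>s. G (x + s *\<^sub>R e)) s"
proof (induction m arbitrary: s)
  case (Suc m)
  have "x + s *\<^sub>R e + t *\<^sub>R e = x + (s + t) *\<^sub>R e" by (simp add: algebra_simps)
  then show ?case
    by (simp only: funpow.simps o_def Suc fdiff_def[of "t *\<^sub>R e" "(fdiff (t *\<^sub>R e) ^^ m) G"]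
        fdiff_def[of t "(fdiff t ^^ m) (\<lambda>s. G (x + s *\<^sub>R e))"])
qed simp

section \<open>The error estimate\<close>

text \<open>Sums over infinite sets are 0 by convention, so finiteness is what lets the norm
  dominate its single terms.\<close>

lemma finite_B3: "finite (B3 k)"
proof (rule finite_subset)
  show "B3 k \<subseteq> PiE UNIV (\<lambda>_. {..k})"
  proof
    fix \<beta> :: "3 \<Rightarrow> nat" assume "\<beta> \<in> B3 k"
    then have "(\<Sum>i\<in>UNIV. \<beta> i) \<le> k" by (simp add: B3_def mi_order_def)
    moreover have "\<beta> i \<le> (\<Sum>i\<in>UNIV. \<beta> i)" for i by (rule member_le_sum) auto
    ultimately have "\<beta> i \<le> k" for i using order_trans by blast
    then show "\<beta> \<in> PiE UNIV (\<lambda>_. {..k})" by auto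
  qed
  show "finite (PiE (UNIV :: 3 set) (\<lambda>_. {..k}))" by (intro finite_PiE) auto
qed

text \<open>The two poles. They keep the suprema in \<open>sphere_qty\<close> from ranging over
  empty sets, where their value would be unspecified.\<close>

lemma S2_two_points: "\<exists>\<xi>\<in>S2. \<exists>\<eta>\<in>S2. \<xi> \<noteq> \<eta>"
proof (intro bexI)
  show "dfs_phi (0, 0) \<noteq> dfs_phi (0, pi)"
    using xyz_nth(2) by (metis dfs_phi_xyz snd_conv cos_zero cos_pi one_neq_neg_one)
qed (rule dfs_phi_in_S2)+

text \<open>The bounds on \<open>U\<close> in the definition of the class make every supremum a
  genuine upper bound, and all summands are nonnegative, so the total dominates each of
  them.\<close>

lemma sphere_qty_ge_Dlist:
  assumes U: "open U" "S2 \<subseteq> U" and C: "Cka_open k \<alpha> U g"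
  shows "\<And>ds \<xi>. length ds \<le> k \<Longrightarrow> \<xi> \<in> S2 \<Longrightarrow> cmod (Dlist ds g \<xi>) \<le> sphere_qty k \<alpha> g"
    and "\<And>ds \<xi> \<eta>. \<alpha> > 0 \<Longrightarrow> length ds = k \<Longrightarrow> \<xi> \<in> S2 \<Longrightarrow> \<eta> \<in> S2 \<Longrightarrow>
       cmod (Dlist ds g \<xi> - Dlist ds g \<eta>) \<le> sphere_qty k \<alpha> g * norm (\<xi> - \<eta>) powr \<alpha>"
proof -
  define P where "P = (\<lambda>\<beta>. SUP \<xi>\<in>S2. cmod (Dmi \<beta> g \<xi>))"
  define I where "I = {(\<beta>, \<xi>, \<eta>). mi_order \<beta> = k \<and> \<xi> \<in> S2 \<and> \<eta> \<in> S2 \<and> \<xi> \<noteq> \<eta>}"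
  define q where "q = (\<lambda>(\<beta>, \<xi>, \<eta>). cmod (Dmi \<beta> g \<xi> - Dmi \<beta> g \<eta>) / norm (\<xi> - \<eta>) powr \<alpha>)"
  define H where "H = (if \<alpha> > 0 then (SUP z\<in>I. q z) else 0)"
  have qty: "sphere_qty k \<alpha> g = (\<Sum>\<beta>\<in>B3 k. P \<beta>) + H"
    unfolding sphere_qty_def P_def H_def I_def q_def by simp
  have Ck: "Ck_open k U g" using C by (simp add: Cka_open_def)
  have bdd: "bdd_above ((\<lambda>\<xi>. cmod (Dmi \<beta> g \<xi>)) ` S2)" if "\<beta> \<in> B3 k" for \<beta>
  proof -
    have "bounded (Dlist (mi_list \<beta>) g ` U)"
      using Ck that by (simp add: Ck_open_def length_mi_list B3_def)
    then obtain K where "\<And>x. x \<in> U \<Longrightarrow> cmod (Dmi \<beta> g x) \<le> K"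
      unfolding Dmi_def by (auto simp: bounded_iff)
    then show ?thesis using U(2) by (intro bdd_aboveI2[where M = K]) auto
  qed
  obtain \<xi>\<^sub>0 \<eta>\<^sub>0 where pts: "\<xi>\<^sub>0 \<in> S2" "\<eta>\<^sub>0 \<in> S2" "\<xi>\<^sub>0 \<noteq> \<eta>\<^sub>0" using S2_two_points by blast
  have Pge: "cmod (Dmi \<beta> g \<xi>) \<le> P \<beta>" if "\<beta> \<in> B3 k" "\<xi> \<in> S2" for \<beta> \<xi>
    unfolding P_def using that by (intro cSUP_upper bdd)
  have P0: "0 \<le> P \<beta>" if "\<beta> \<in> B3 k" for \<beta>
    using Pge[OF that pts(1)] norm_ge_zero order_trans by blast
  have qbdd: "bdd_above (q ` I)" if pos: "\<alpha> > 0"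
  proof -
    obtain K where "\<And>\<beta> x y. mi_order \<beta> = k \<Longrightarrow> x \<in> U \<Longrightarrow> y \<in> U \<Longrightarrow> x \<noteq> y \<Longrightarrow>
        cmod (Dmi \<beta> g x - Dmi \<beta> g y) / norm (x - y) powr \<alpha> \<le> K"
      using C pos unfolding Cka_open_def Holder_open_def by blast
    then show ?thesis using U(2) by (intro bdd_aboveI2[where M = K]) (auto simp: I_def q_def)
  qed
  have Hge: "q z \<le> H" if "\<alpha> > 0" "z \<in> I" for z
    using that qbdd by (auto simp: H_def intro: cSUP_upper)
  have H0: "0 \<le> H"
  proof (cases "\<alpha> > 0")
    case True
    \<comment> \<open>Any multi-index of order \<open>k\<close> would do; one is needed to see that
      the Hoelder supremum is nonnegative.\<close>
    have z: "(mi_count (replicate k 0), \<xi>\<^sub>0, \<eta>\<^sub>0) \<in> I" using pts by (simp add: I_def mi_order_count)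
    have "0 \<le> q (mi_count (replicate k 0), \<xi>\<^sub>0, \<eta>\<^sub>0)" by (simp add: q_def)
    then show ?thesis using Hge[OF True z] by linarith
  qed (simp add: H_def)
  show "cmod (Dlist ds g \<xi>) \<le> sphere_qty k \<alpha> g" if "length ds \<le> k" "\<xi> \<in> S2" for ds \<xi>
  proof -
    have \<beta>: "mi_count ds \<in> B3 k" using that by (simp add: B3_def mi_order_count)
    have "cmod (Dlist ds g \<xi>) \<le> P (mi_count ds)"
      using Pge[OF \<beta> that(2)] Dlist_eq_Dmi[OF U(1) Ck that(1)] U(2) that(2) by auto
    also have "\<dots> \<le> (\<Sum>\<beta>\<in>B3 k. P \<beta>)" using \<beta> P0 by (intro member_le_sum finite_B3) auto
    finally show ?thesis using H0 qty by linarith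
  qed
  show "cmod (Dlist ds g \<xi> - Dlist ds g \<eta>) \<le> sphere_qty k \<alpha> g * norm (\<xi> - \<eta>) powr \<alpha>"
    if "\<alpha> > 0" "length ds = k" "\<xi> \<in> S2" "\<eta> \<in> S2" for ds \<xi> \<eta>
  proof (cases "\<xi> = \<eta>")
    case False
    have "q (mi_count ds, \<xi>, \<eta>) \<le> H" using that False by (intro Hge) (auto simp: I_def mi_order_count)
    also have "\<dots> \<le> sphere_qty k \<alpha> g" using qty P0 sum_nonneg[of "B3 k" P] by simp
    finally have "cmod (Dlist ds g \<xi> - Dlist ds g \<eta>) / norm (\<xi> - \<eta>) powr \<alpha> \<le> sphere_qty k \<alpha> g"
      using Dlist_eq_Dmi[OF U(1) Ck, of ds] subsetD[OF U(2)] that by (simp add: q_def)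
    then show ?thesis using False by (simp add: divide_le_eq)
  qed simp
qed

text \<open>Both readings of the norm lead to the Hoelder constant \<open>6 * B\<close> along a
  circle. For \<open>\<alpha> = 1\<close> it is the sum over three partial derivatives with velocity
  factors at most 2; for \<open>\<alpha> < 1\<close> the Lipschitz constant 2 of the circle
  contributes \<open>2 powr \<alpha>\<close>, which is below 6.\<close>

lemma dfs_tilde_fdiff_bound:
  assumes \<alpha>: "0 < \<alpha>" "\<alpha> \<le> 1" and U: "open U" "S2 \<subseteq> U"
    and C: "if \<alpha> = 1 then Cka_open (k + 1) 0 U g else Cka_open k \<alpha> U g"
    and B: "B = (if \<alpha> = 1 then sphere_qty (k + 1) 0 g else sphere_qty k \<alpha> g)"
    and e: "e = (1, 0) \<or> e = (0, 1)" and t: "t > 0"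
  shows "0 \<le> B \<and> cmod ((fdiff (t *\<^sub>R e) ^^ Suc k) (\<lambda>x. g (dfs_phi x)) x)
     \<le> (18 * 3 ^ k) ^ k * (6 * B) * t powr (real k + \<alpha>)"
proof -
  obtain p u v where uv: "norm u \<le> 1" "norm v \<le> 1"
    and curve: "\<And>s. dfs_phi (x + s *\<^sub>R e) = circle_curve p u v s"
    using dfs_phi_coordinate_curve[OF e] by blast
  have on: "circle_curve p u v s \<in> S2" for s using dfs_phi_in_S2 curve by metis
  have Ck: "Ck_open k U g"
    using C by (auto simp: Cka_open_def Ck_open_def split: if_splits)
  have bound: "cmod (Dlist ds g \<xi>) \<le> B" if "\<xi> \<in> S2" "length ds \<le> k \<or> \<alpha> = 1 \<and> length ds = k + 1" for ds \<xi>
  proof (cases "\<alpha> = 1")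
    case True
    then show ?thesis using sphere_qty_ge_Dlist(1)[OF U, of "k + 1" 0 g ds \<xi>] C B that by auto
  next
    case False
    then show ?thesis using sphere_qty_ge_Dlist(1)[OF U, of k \<alpha> g ds \<xi>] C B that by auto
  qed
  have B0: "0 \<le> B" using bound[OF on[of 0], of "[]"] norm_ge_zero order_trans by (metis le0 list.size(3))
  have holder: "cmod (Dlist ds g (circle_curve p u v s) - Dlist ds g (circle_curve p u v t)) \<le> (6 * B) * \<bar>s - t\<bar> powr \<alpha>"
    if len: "length ds = k" for ds s t
  proof (cases "\<alpha> = 1")
    case True
    \<comment> \<open>The bound on derivatives of order \<open>k + 1\<close> is integrated along the
      circle, which lies in the sphere, unlike the chord.\<close>
    let ?d = "\<lambda>s. \<Sum>i\<in>UNIV. (v $ i * cos s + (- u $ i) * sin s) *\<^sub>R pdiff i (Dlist ds g) (circle_curve p u v s)"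
    have "cmod (Dlist ds g (circle_curve p u v s) - Dlist ds g (circle_curve p u v t)) \<le> (6 * B) * \<bar>s - t\<bar>"
    proof (rule vector_derivative_bound_diff[where f' = ?d])
      fix r
      have "Ck_open (Suc k) U g" using C True by (simp add: Cka_open_def)
      then show "((\<lambda>s. Dlist ds g (circle_curve p u v s)) has_vector_derivative ?d r) (at r)"
        using on U len by (intro has_vector_derivative_comp_circle_curve) auto
      have comp: "\<bar>u $ i\<bar> \<le> 1" "\<bar>v $ i\<bar> \<le> 1" for i
        using uv component_le_norm_cart[of u i] component_le_norm_cart[of v i] by linarith+
      have "cmod ((v $ i * cos r + (- u $ i) * sin r) *\<^sub>R pdiff i (Dlist ds g) (circle_curve p u v r)) \<le> 2 * B" for i
      proof -
        have "cmod (pdiff i (Dlist ds g) (circle_curve p u v r)) \<le> B"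
          using bound[OF on, of "i # ds" r] True len by simp
        moreover have "\<bar>v $ i * cos r + (- u $ i) * sin r\<bar> \<le> 2"
          using comp by (intro trig_bound) auto
        ultimately show ?thesis unfolding norm_scaleR by (intro mult_mono) auto
      qed
      then have "cmod (?d r) \<le> (\<Sum>i\<in>(UNIV::3 set). 2 * B)" by (intro sum_norm_le)
      then show "cmod (?d r) \<le> 6 * B" by simp
    qed
    then show ?thesis using True by simp
  next
    case False
    have "cmod (Dlist ds g (circle_curve p u v s) - Dlist ds g (circle_curve p u v t))
        \<le> B * norm (circle_curve p u v s - circle_curve p u v t) powr \<alpha>"
      using sphere_qty_ge_Dlist(2)[OF U, of k \<alpha> g ds] False C B len on \<alpha> by simp
    also have "\<dots> \<le> B * (2 * \<bar>s - t\<bar>) powr \<alpha>"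
      using circle_curve_Lipschitz[OF uv] \<alpha> B0 by (intro mult_left_mono powr_mono2) auto
    also have "\<dots> = (B * 2 powr \<alpha>) * \<bar>s - t\<bar> powr \<alpha>" by (simp add: powr_mult)
    also have "\<dots> \<le> (6 * B) * \<bar>s - t\<bar> powr \<alpha>"
    proof (rule mult_right_mono)
      have "2 powr \<alpha> \<le> 2 powr (1::real)" using \<alpha> by (intro powr_mono) auto
      then have "B * 2 powr \<alpha> \<le> B * 6" using B0 by (intro mult_left_mono) auto
      then show "B * 2 powr \<alpha> \<le> 6 * B" by simp
    qed simp
    finally show ?thesis .
  qed
  have "cmod (Dlist ds g (circle_curve p u v s)) \<le> 6 * B" if "length ds \<le> k" for ds s
    using bound[OF on, of ds s] that B0 by simp
  then have "holder_class \<alpha> k ((18 * 3 ^ k) ^ k * (6 * B)) (\<lambda>s. g (circle_curve p u v s))"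
    using on U B0 by (intro holder_class_comp_circle_curve[OF \<alpha> U(1) uv _ Ck _ holder]) auto
  from holder_class_fdiff_bound[OF t this, of 0] B0 show ?thesis
    using fdiff_along_line[where x = x and s = 0 and m = "Suc k" and t = t and e = e and G = "\<lambda>x. g (dfs_phi x)"]
    by (simp only: curve scaleR_zero_left add_0_right simp_thms)
qed

lemma Kh_error_bound:
  assumes \<alpha>: "0 < \<alpha>" "\<alpha> \<le> 1" and k: "k \<ge> 1" and U: "open U" "S2 \<subseteq> U"
    and C: "if \<alpha> = 1 then Cka_open (k + 1) 0 U g else Cka_open k \<alpha> U g"
    and B: "B = (if \<alpha> = 1 then sphere_qty (k + 1) 0 g else sphere_qty k \<alpha> g)"
    and fg: "\<And>\<xi>. \<xi> \<in> S2 \<Longrightarrow> g \<xi> = f \<xi>" and h: "h \<ge> 1" and \<xi>: "\<xi> \<in> S2"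
    and r: "r = real k + \<alpha>"
  shows "cmod (f \<xi> - Kh h f \<xi>) \<le> 16 * 2 ^ k * (4 powr (r - 1) / (1 - 2 powr (1 - r)))
      * ((18 * 3 ^ k) ^ k * (6 * B)) * real h powr (1 - r)"
proof -
  define K where "K = 16 * 2 ^ k * (4 powr (r - 1) / (1 - 2 powr (1 - r))) * ((18 * 3 ^ k) ^ k * (6 * B))"
  have tilde: "dfs_tilde f = (\<lambda>x. g (dfs_phi x))"
    by (simp add: dfs_tilde_def fun_eq_iff fg dfs_phi_in_S2)
  have "continuous_on U g"
    using C Ck_open_continuous[of _ U g "[]"] by (auto simp: Cka_open_def split: if_splits)
  then have app: "trig_approximable (dfs_tilde f)"
    unfolding tilde by (intro trig_approximable_dfs continuous_on_subset[OF _ U(2)])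
  note bnd = dfs_tilde_fdiff_bound[OF \<alpha> U C B, folded tilde r]
  have B0: "0 \<le> B" using bnd[of "(1, 0)" 1 0] by simp
  \<comment> \<open>\<open>k \<ge> 1\<close> enters here: the exponent \<open>1 - r\<close> is
    negative, so the shells are summable and the error tends to 0.\<close>
  have r1: "r > 1" using r k \<alpha> by simp
  have "cmod (dfs_tilde f (dfs_phi_inv \<xi>) - (\<Sum>n\<in>disc h. fourier_coeff (dfs_tilde f) n * cis (ip n (dfs_phi_inv \<xi>))))
      \<le> K * real h powr (1 - r)"
  proof (rule fourier_partial_sum_error[OF app _ _ h, where R = "\<lambda>h. K * real h powr (1 - r)"])
    fix h' :: nat and F :: "(int \<times> int) set" assume "h' \<ge> 1" "finite F" "F \<inter> disc h' = {}"
    then show "(\<Sum>n\<in>F. cmod (fourier_coeff (dfs_tilde f) n)) \<le> K * real h' powr (1 - r)"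
      unfolding K_def using B0 bnd by (intro tail_sum_bound[OF app _ r1]) auto
  next
    have "((\<lambda>h. real h powr (1 - r)) \<longlongrightarrow> 0) sequentially"
      using r1 by (intro tendsto_neg_powr filterlim_real_sequentially) auto
    then show "(\<lambda>h. K * real h powr (1 - r)) \<longlonglongrightarrow> 0" by (rule tendsto_mult_right_zero)
  qed
  then show ?thesis
    unfolding Kh_eq_disc_sum[OF app] K_def using dfs_phi_inv[OF \<xi>] by (simp add: dfs_tilde_def)
qed

theorem theorem5p9:
  fixes k :: nat and \<alpha> :: real
  assumes "k \<ge> 1" and "0 < \<alpha>" and "\<alpha> \<le> 1"
  shows "\<exists>M. \<forall>f h. in_Cka_S2 k \<alpha> f \<longrightarrow> h \<ge> 1 \<longrightarrow>
           sup_norm_S2 (\<lambda>\<xi>. f \<xi> - Kh h f \<xi>)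
             \<le> M * norm_Cka_S2 k \<alpha> f * real h powr (1 - real k - \<alpha>)"
proof -
  define r where "r = real k + \<alpha>"
  define K where "K = 16 * 2 ^ k * (4 powr (r - 1) / (1 - 2 powr (1 - r))) * ((18 * 3 ^ k) ^ k * 6)"
  have "2 powr (1 - r) < (1::real)" using assms by (simp add: r_def powr_less_one)
  then have K0: "K > 0" by (simp add: K_def)
  have "sup_norm_S2 (\<lambda>\<xi>. f \<xi> - Kh h f \<xi>) \<le> K * norm_Cka_S2 k \<alpha> f * real h powr (1 - real k - \<alpha>)"
    if f: "in_Cka_S2 k \<alpha> f" and h: "h \<ge> 1" for f h
  proof -
    \<comment> \<open>These parameters absorb the convention for
      \<open>\<alpha> = 1\<close>.\<close>
    define k' where "k' = (if \<alpha> = 1 then k + 1 else k)"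
    define \<alpha>' where "\<alpha>' = (if \<alpha> = 1 then 0 else \<alpha>)"
    define H where "H = real h powr (1 - r)"
    have H: "H > 0" using h by (simp add: H_def)
    have ne: "extensions k' \<alpha>' f \<noteq> {}"
      using f by (auto simp: in_Cka_S2_def in_Cka_raw_def k'_def \<alpha>'_def)
    \<comment> \<open>\<open>K\<close> and \<open>H\<close> do not depend on the extension, so
      dividing by them gives a lower bound for every element of the set whose infimum is the
      norm.\<close>
    have "sup_norm_S2 (\<lambda>\<xi>. f \<xi> - Kh h f \<xi>) / (K * H) \<le> Inf (sphere_qty k' \<alpha>' ` extensions k' \<alpha>' f)"
    proof (rule cInf_greatest)
      fix B assume "B \<in> sphere_qty k' \<alpha>' ` extensions k' \<alpha>' f"
      then obtain g U where g: "B = sphere_qty k' \<alpha>' g" "open U" "S2 \<subseteq> U" "Cka_open k' \<alpha>' U g"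
          "\<And>\<xi>. \<xi> \<in> S2 \<Longrightarrow> g \<xi> = f \<xi>"
        by (auto simp: extensions_def)
      have "sup_norm_S2 (\<lambda>\<xi>. f \<xi> - Kh h f \<xi>) \<le> K * B * H"
        unfolding sup_norm_S2_def
      proof (rule cSUP_least)
        show "S2 \<noteq> {}" using S2_two_points by blast
        fix \<xi> assume "\<xi> \<in> S2"
        then have "cmod (f \<xi> - Kh h f \<xi>) \<le> 16 * 2 ^ k * (4 powr (r - 1) / (1 - 2 powr (1 - r)))
            * ((18 * 3 ^ k) ^ k * (6 * B)) * real h powr (1 - r)"
          using assms g h by (intro Kh_error_bound[where U = U and g = g and \<alpha> = \<alpha>])
            (auto simp: r_def k'_def \<alpha>'_def)
        also have "\<dots> = K * B * H" by (simp add: K_def H_def)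
        finally show "cmod (f \<xi> - Kh h f \<xi>) \<le> K * B * H" .
      qed
      then show "sup_norm_S2 (\<lambda>\<xi>. f \<xi> - Kh h f \<xi>) / (K * H) \<le> B"
        using K0 H by (simp add: pos_divide_le_eq mult_ac)
    qed (use ne in simp)
    moreover have "Inf (sphere_qty k' \<alpha>' ` extensions k' \<alpha>' f) = norm_Cka_S2 k \<alpha> f"
      by (simp add: norm_Cka_S2_def norm_Cka_raw_def k'_def \<alpha>'_def)
    ultimately have "sup_norm_S2 (\<lambda>\<xi>. f \<xi> - Kh h f \<xi>) \<le> K * norm_Cka_S2 k \<alpha> f * H"
      using K0 H by (simp add: pos_divide_le_eq mult_ac)
    then show ?thesis by (simp add: H_def r_def diff_diff_eq)
  qed
  then show ?thesis by blast
qed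

end
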